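(* Let $m\ge 2$ be an integer. Suppose that the bilinear form $B$ is continuous and coercive on $V=H_0^1(\Omega)$, i.e. there are constants $\alpha,\beta>0$ with $|B(u,v)|\le \alpha\|u\|_{H^1(\Omega)}\|v\|_{H^1(\Omega)}$ and $\beta\|u\|_{H^1(\Omega)}^2\le |B(u,u)|$ for all $u,v\in V$, and that $F$ is a continuous linear functional on $V$. Suppose that the finite element spaces $V_h$ have approximation order $m$, i.e. there is a constant $C_0$, independent of $h$, such that $$\|v-\mathcal{I}_h v\|_{H^1(\Omega)}\le C_0\,h^{m-1}|v|_{H^m(\Omega)}\qquad\text{for all } v\in H^m(\Omega)\cap H_0^1(\Omega).$$ Let $u_\theta$ be smooth on $\overline\Omega$ with $u_\theta=0$ on $\partial\Omega$, let $V_h^+=\{w+u_\theta : w\in V_h\}$, and let $u\in V\cap H^m(\Omega)$ satisfy $B(u,v)=F(v)$ for all $v\in V$. Then the solution $u_h\in V_h^+$ of the problem: find $u_h\in V_h^+$, with $w_h=u_h-u_\theta\in V_h$, such that $$B(w_h,v)=F(v)-B(u_\theta,v)\qquad\text{for all } v\in V_h,$$ satisfies $$\|u-u_h\|_{H^1(\Omega)}\le C\,h^{m-1}\,|u-u_\theta|_{H^m(\Omega)},$$ where $C>0$ is a constant independent of $h$, $u$ and $u_\theta$.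
   Context: $\Omega\subset\mathbb{R}^d$ is a bounded, sufficiently regular domain. The elliptic problem is $-\nabla\cdot(a\nabla u)+cu=f$ in $\Omega$, $u=0$ on $\partial\Omega$, with weak form on $V=H_0^1(\Omega)$ given by $B(u,v)=\int_\Omega a\nabla u\cdot\nabla v+c\,u\,v\,\mathrm{d}x$ and $F(v)=\int_\Omega f v\,\mathrm{d}x$. For each mesh size $h$, $\mathcal{T}^h$ is a subdivision of $\Omega$ and $V_h\subset H_0^1(\Omega)$ is the finite-dimensional (Lagrange) finite element space of functions in $H_0^1(\Omega)$ that are polynomials of a fixed degree on each element of $\mathcal{T}^h$; $\mathcal{I}_h$ is the global interpolator with values in $V_h$. $u_\theta:\overline\Omega\to\mathbb{R}$ is a given fixed function (in applications, the output of a trained neural network that satisfies the boundary condition exactly). $|\cdot|_{H^m(\Omega)}$ is the Sobolev seminorm consisting of the derivatives of order exactly $m$. *)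

theory Defs
  imports "HOL-Analysis.Analysis" "HOL-Library.Multiset"
begin

definition partial_deriv :: "'a::euclidean_space \<Rightarrow> ('a \<Rightarrow> real) \<Rightarrow> 'a \<Rightarrow> real" where
  "partial_deriv b f = (\<lambda>x. frechet_derivative f (at x) b)"

definition iter_partial :: "'a::euclidean_space list \<Rightarrow> ('a \<Rightarrow> real) \<Rightarrow> 'a \<Rightarrow> real" where
  "iter_partial bs f = foldr partial_deriv bs f"

text \<open>Used for open \<open>S\<close> only.\<close>

primrec Ck_on :: "nat \<Rightarrow> ('a::euclidean_space \<Rightarrow> real) \<Rightarrow> 'a set \<Rightarrow> bool" where
  "Ck_on 0 f S \<longleftrightarrow> continuous_on S f"
| "Ck_on (Suc n) f S \<longleftrightarrow>
     (\<forall>x\<in>S. f differentiable (at x)) \<and> (\<forall>v. Ck_on n (partial_deriv v f) S)"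

definition smooth_on :: "'a::euclidean_space set \<Rightarrow> ('a \<Rightarrow> real) \<Rightarrow> bool" where
  "smooth_on S f \<longleftrightarrow> (\<forall>n. Ck_on n f S)"

text \<open>\<open>f \<in> C\<^sup>\<infinity>\<close> up to the boundary of \<open>\<Omega>\<close>: all partial derivatives on the open set \<open>\<Omega>\<close>
  extend continuously to the closure. Values of \<open>f\<close> outside the closure play no role.\<close>

definition smooth_on_closure :: "'a::euclidean_space set \<Rightarrow> ('a \<Rightarrow> real) \<Rightarrow> bool" where
  "smooth_on_closure \<Omega> f \<longleftrightarrow>
     smooth_on \<Omega> f \<and> continuous_on (closure \<Omega>) f \<and>
     (\<forall>bs. set bs \<subseteq> Basis \<longrightarrow>
        (\<exists>g. continuous_on (closure \<Omega>) g \<and> (\<forall>x\<in>\<Omega>. g x = iter_partial bs f x)))"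

definition test_functions :: "'a::euclidean_space set \<Rightarrow> ('a \<Rightarrow> real) set" where
  "test_functions \<Omega> =
     {\<phi>. smooth_on UNIV \<phi> \<and> compact (closure {x. \<phi> x \<noteq> 0}) \<and> closure {x. \<phi> x \<noteq> 0} \<subseteq> \<Omega>}"

text \<open>A multi-index is a multiset \<open>\<alpha>\<close> of coordinate directions: \<open>count \<alpha> b\<close> is the order in direction
  \<open>b\<close>, and \<open>size \<alpha>\<close> is the total order.\<close>

definition multi_indices :: "'a::euclidean_space multiset set" where
  "multi_indices = {\<alpha>. set_mset \<alpha> \<subseteq> Basis}"

text \<open>The order of differentiation is chosen arbitrarily; it is irrelevant for smooth \<open>f\<close>, the only
  functions to which this operator is applied.\<close>

definition multi_partial :: "'a::euclidean_space multiset \<Rightarrow> ('a \<Rightarrow> real) \<Rightarrow> 'a \<Rightarrow> real" where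
  "multi_partial \<alpha> f = iter_partial (SOME bs. mset bs = \<alpha>) f"

text \<open>Elements of \<open>L\<^sup>2(\<Omega>)\<close>, \<open>H\<^sup>m(\<Omega>)\<close> and \<open>H\<^sup>1\<^sub>0(\<Omega>)\<close> are represented by total functions; only their
  values almost everywhere on \<open>\<Omega>\<close> matter.\<close>

definition L2 :: "'a::euclidean_space set \<Rightarrow> ('a \<Rightarrow> real) set" where
  "L2 \<Omega> = {u. u \<in> borel_measurable (lebesgue_on \<Omega>) \<and> integrable (lebesgue_on \<Omega>) (\<lambda>x. (u x)\<^sup>2)}"

definition has_weak_deriv ::
    "'a::euclidean_space set \<Rightarrow> 'a multiset \<Rightarrow> ('a \<Rightarrow> real) \<Rightarrow> ('a \<Rightarrow> real) \<Rightarrow> bool" where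
  "has_weak_deriv \<Omega> \<alpha> u g \<longleftrightarrow>
     (\<forall>\<phi>\<in>test_functions \<Omega>.
        (LINT x|lebesgue_on \<Omega>. u x * multi_partial \<alpha> \<phi> x) =
        (- 1) ^ size \<alpha> * (LINT x|lebesgue_on \<Omega>. g x * \<phi> x))"

definition sobolev :: "nat \<Rightarrow> 'a::euclidean_space set \<Rightarrow> ('a \<Rightarrow> real) set" where
  "sobolev m \<Omega> =
     {u \<in> L2 \<Omega>. \<forall>\<alpha>\<in>multi_indices. size \<alpha> \<le> m \<longrightarrow> (\<exists>g\<in>L2 \<Omega>. has_weak_deriv \<Omega> \<alpha> u g)}"

text \<open>Weak derivatives are unique up to null sets, so the choice of representative is immaterial.\<close>

definition weak_deriv ::
    "'a::euclidean_space set \<Rightarrow> 'a multiset \<Rightarrow> ('a \<Rightarrow> real) \<Rightarrow> 'a \<Rightarrow> real" where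
  "weak_deriv \<Omega> \<alpha> u = (SOME g. g \<in> L2 \<Omega> \<and> has_weak_deriv \<Omega> \<alpha> u g)"

definition weak_grad :: "'a::euclidean_space set \<Rightarrow> ('a \<Rightarrow> real) \<Rightarrow> 'a \<Rightarrow> 'a" where
  "weak_grad \<Omega> u x = (\<Sum>b\<in>Basis. weak_deriv \<Omega> {#b#} u x *\<^sub>R b)"

definition sobolev_norm :: "nat \<Rightarrow> 'a::euclidean_space set \<Rightarrow> ('a \<Rightarrow> real) \<Rightarrow> real" where
  "sobolev_norm m \<Omega> u =
     sqrt (\<Sum>\<alpha>\<in>{\<alpha>\<in>multi_indices. size \<alpha> \<le> m}. LINT x|lebesgue_on \<Omega>. (weak_deriv \<Omega> \<alpha> u x)\<^sup>2)"

definition sobolev_seminorm :: "nat \<Rightarrow> 'a::euclidean_space set \<Rightarrow> ('a \<Rightarrow> real) \<Rightarrow> real" where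
  "sobolev_seminorm m \<Omega> u =
     sqrt (\<Sum>\<alpha>\<in>{\<alpha>\<in>multi_indices. size \<alpha> = m}. LINT x|lebesgue_on \<Omega>. (weak_deriv \<Omega> \<alpha> u x)\<^sup>2)"

definition H10 :: "'a::euclidean_space set \<Rightarrow> ('a \<Rightarrow> real) set" where
  "H10 \<Omega> = {u \<in> sobolev 1 \<Omega>. \<exists>\<phi> :: nat \<Rightarrow> 'a \<Rightarrow> real.
      (\<forall>n. \<phi> n \<in> test_functions \<Omega>) \<and>
      (\<lambda>n. sobolev_norm 1 \<Omega> (\<lambda>x. u x - \<phi> n x)) \<longlonglongrightarrow> 0}"

definition B_integrand :: "'a::euclidean_space set \<Rightarrow> ('a \<Rightarrow> real) \<Rightarrow> ('a \<Rightarrow> real) \<Rightarrow>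
    ('a \<Rightarrow> real) \<Rightarrow> ('a \<Rightarrow> real) \<Rightarrow> 'a \<Rightarrow> real" where
  "B_integrand \<Omega> a c u v x = (a x *\<^sub>R weak_grad \<Omega> u x) \<bullet> weak_grad \<Omega> v x + c x * u x * v x"

definition B_form :: "'a::euclidean_space set \<Rightarrow> ('a \<Rightarrow> real) \<Rightarrow> ('a \<Rightarrow> real) \<Rightarrow>
    ('a \<Rightarrow> real) \<Rightarrow> ('a \<Rightarrow> real) \<Rightarrow> real" where
  "B_form \<Omega> a c u v = (LINT x|lebesgue_on \<Omega>. B_integrand \<Omega> a c u v x)"

definition F_form :: "'a::euclidean_space set \<Rightarrow> ('a \<Rightarrow> real) \<Rightarrow> ('a \<Rightarrow> real) \<Rightarrow> real" where
  "F_form \<Omega> f v = (LINT x|lebesgue_on \<Omega>. f x * v x)"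

text \<open>The Bochner integral of a non-integrable function is \<open>0\<close>, so in the next three definitions
  integrability has to be demanded explicitly: it says that \<open>B\<close> and \<open>F\<close> are defined on
  \<open>V = H\<^sup>1\<^sub>0(\<Omega>)\<close>. Their (bi)linearity is then a consequence of the formulas above.\<close>

definition B_continuous :: "'a::euclidean_space set \<Rightarrow> ('a \<Rightarrow> real) \<Rightarrow> ('a \<Rightarrow> real) \<Rightarrow> bool" where
  "B_continuous \<Omega> a c \<longleftrightarrow>
     (\<forall>u\<in>H10 \<Omega>. \<forall>v\<in>H10 \<Omega>. integrable (lebesgue_on \<Omega>) (B_integrand \<Omega> a c u v)) \<and>
     (\<exists>\<alpha>>0. \<forall>u\<in>H10 \<Omega>. \<forall>v\<in>H10 \<Omega>.
        \<bar>B_form \<Omega> a c u v\<bar> \<le> \<alpha> * sobolev_norm 1 \<Omega> u * sobolev_norm 1 \<Omega> v)"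

definition B_coercive :: "'a::euclidean_space set \<Rightarrow> ('a \<Rightarrow> real) \<Rightarrow> ('a \<Rightarrow> real) \<Rightarrow> bool" where
  "B_coercive \<Omega> a c \<longleftrightarrow>
     (\<forall>u\<in>H10 \<Omega>. integrable (lebesgue_on \<Omega>) (B_integrand \<Omega> a c u u)) \<and>
     (\<exists>\<beta>>0. \<forall>u\<in>H10 \<Omega>. \<beta> * (sobolev_norm 1 \<Omega> u)\<^sup>2 \<le> \<bar>B_form \<Omega> a c u u\<bar>)"

definition F_continuous :: "'a::euclidean_space set \<Rightarrow> ('a \<Rightarrow> real) \<Rightarrow> bool" where
  "F_continuous \<Omega> f \<longleftrightarrow>
     (\<forall>v\<in>H10 \<Omega>. integrable (lebesgue_on \<Omega>) (\<lambda>x. f x * v x)) \<and>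
     (\<exists>M. \<forall>v\<in>H10 \<Omega>. \<bar>F_form \<Omega> f v\<bar> \<le> M * sobolev_norm 1 \<Omega> v)"

definition poly_functions :: "nat \<Rightarrow> ('a::euclidean_space \<Rightarrow> real) set" where
  "poly_functions k =
     {p. \<exists>coef. \<forall>x. p x = (\<Sum>\<alpha>\<in>{\<alpha>\<in>multi_indices. size \<alpha> \<le> k}. coef \<alpha> * (\<Prod>b\<in>#\<alpha>. x \<bullet> b))}"

definition subdivision :: "'a::euclidean_space set \<Rightarrow> 'a set set \<Rightarrow> bool" where
  "subdivision \<Omega> T \<longleftrightarrow>
     finite T \<and> (\<forall>K\<in>T. compact K \<and> interior K \<noteq> {}) \<and>
     (\<forall>K\<in>T. \<forall>L\<in>T. K \<noteq> L \<longrightarrow> interior K \<inter> interior L = {}) \<and>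
     \<Union>T = closure \<Omega>"

text \<open>\<open>N\<close> is a unisolvent set of Lagrange nodes on \<open>K\<close> for the polynomials of degree at most \<open>k\<close>.\<close>

definition lagrange_nodes :: "nat \<Rightarrow> 'a::euclidean_space set \<Rightarrow> 'a set \<Rightarrow> bool" where
  "lagrange_nodes k K N \<longleftrightarrow>
     finite N \<and> N \<subseteq> K \<and> (\<forall>y. \<exists>!p. p \<in> poly_functions k \<and> (\<forall>x\<in>N. p x = y x))"

text \<open>Since functions are total, they are normalised to be \<open>0\<close> outside the closure of \<open>\<Omega>\<close>; for a
  subdivision \<open>T\<close> of \<open>\<Omega>\<close> this makes the space finite-dimensional.\<close>

definition fe_space :: "'a::euclidean_space set \<Rightarrow> nat \<Rightarrow> 'a set set \<Rightarrow> ('a \<Rightarrow> real) set" where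
  "fe_space \<Omega> k T =
     {v \<in> H10 \<Omega>. (\<forall>K\<in>T. \<exists>p\<in>poly_functions k. \<forall>x\<in>K. v x = p x) \<and> (\<forall>x. x \<notin> closure \<Omega> \<longrightarrow> v x = 0)}"

text \<open>\<open>I\<close> is the global interpolator on \<open>H\<^sup>m(\<Omega>) \<inter> H\<^sup>1\<^sub>0(\<Omega>)\<close> with values in the finite element space.
  Nodal values of a Sobolev function are those of its continuous representative. Functions without
  one (which exist if \<open>2 m\<close> does not exceed the dimension) have no nodal values; of their interpolants
  only membership in the finite element space is required.\<close>

definition global_interpolator :: "'a::euclidean_space set \<Rightarrow> nat \<Rightarrow> 'a set set \<Rightarrow> ('a set \<Rightarrow> 'a set) \<Rightarrow>
    nat \<Rightarrow> (('a \<Rightarrow> real) \<Rightarrow> 'a \<Rightarrow> real) \<Rightarrow> bool" where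
  "global_interpolator \<Omega> k T N m I \<longleftrightarrow>
     (\<forall>v\<in>sobolev m \<Omega> \<inter> H10 \<Omega>.
        I v \<in> fe_space \<Omega> k T \<and>
        (\<forall>v'. continuous_on (closure \<Omega>) v' \<and> (AE x in lebesgue_on \<Omega>. v' x = v x) \<longrightarrow>
           (\<forall>K\<in>T. \<forall>x\<in>N K. I v x = v' x)))"

definition enriched_space :: "('a::euclidean_space \<Rightarrow> real) set \<Rightarrow> ('a \<Rightarrow> real) \<Rightarrow> ('a \<Rightarrow> real) set" where
  "enriched_space V u\<theta> = {(\<lambda>x. w x + u\<theta> x) | w. w \<in> V}"

definition enriched_solution :: "'a::euclidean_space set \<Rightarrow> ('a \<Rightarrow> real) \<Rightarrow> ('a \<Rightarrow> real) \<Rightarrow> ('a \<Rightarrow> real) \<Rightarrow>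
    ('a \<Rightarrow> real) set \<Rightarrow> ('a \<Rightarrow> real) \<Rightarrow> ('a \<Rightarrow> real) \<Rightarrow> bool" where
  "enriched_solution \<Omega> a c f V u\<theta> uh \<longleftrightarrow>
     uh \<in> enriched_space V u\<theta> \<and>
     (let wh = (\<lambda>x. uh x - u\<theta> x) in
        wh \<in> V \<and>
        (\<forall>v\<in>V. B_form \<Omega> a c wh v = F_form \<Omega> f v - B_form \<Omega> a c u\<theta> v))"

end

theory Submission
  imports Defs "HOL-Computational_Algebra.Polynomial"
begin

text \<open>The shifted problem has exact solution \<open>w = u - u\<^sub>\<theta>\<close> and Galerkin approximation
  \<open>w\<^sub>h = u\<^sub>h - u\<^sub>\<theta>\<close>, and \<open>u - u\<^sub>h = w - w\<^sub>h\<close>, so the estimate is the quasi-optimality of the Galerkin method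
  combined with the interpolation error of \<open>w\<close>. This requires \<open>u\<^sub>\<theta> \<in> H\<^sup>1\<^sub>0(\<Omega>)\<close>, which holds without any
  regularity of the boundary: the truncations \<open>u\<^sub>\<theta> \<eta>(n u\<^sub>\<theta>)\<close>, with \<open>\<eta>\<close> vanishing near \<open>0\<close>, are themselves
  test functions, because \<open>u\<^sub>\<theta>\<close> is small near the boundary. Since the weak derivatives in the norms and in
  \<open>B\<close> are arbitrarily chosen representatives, all of this rests on their uniqueness almost everywhere.\<close>

section \<open>Calculus of smooth functions\<close>

text \<open>Truncating by the size of the values, and not by the distance to the boundary, is what
  makes a rough boundary harmless: \<open>frontier \<Omega>\<close> enters only through the
  vanishing of the function there. The price is paid in the gradient. The derivatives of the
  truncations lose everything on the zero set, which may have positive measure, so convergence in H1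
  depends on the gradient being zero almost everywhere on that set. The bound on the truncated
  gradients must also be uniform in \<open>n\<close>; this works because the derivative of the
  cutoff depends on \<open>n\<close> and \<open>t\<close> only through the product of the two. A
  single family of functions built from exp(-1/t) serves twice: in the cutoff of the values, and as
  a product over coordinates in the bumps that detect integrals over boxes. The latter is the route
  to uniqueness of weak derivatives: bumps give boxes, boxes give Borel sets, and Borel sets give
  almost everywhere.\<close>

lemma Ck_on_cong:
  fixes f g :: "'a::euclidean_space \<Rightarrow> real"
  assumes "open S" "\<And>x. x \<in> S \<Longrightarrow> f x = g x" "Ck_on n f S"
  shows "Ck_on n g S"
  using assms(2,3)
proof (induction n arbitrary: f g)
  case 0
  then show ?case
    by (simp cong: continuous_on_cong)
next
  case (Suc n)
  have diff: "g differentiable (at x)" if "x \<in> S" for x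
  proof -
    have "f differentiable (at x)" using Suc.prems(2) that by simp
    then obtain f' where "(f has_derivative f') (at x)" by (auto simp: differentiable_def)
    then have "(g has_derivative f') (at x)"
      by (rule has_derivative_transform_within_open[OF _ assms(1) that]) (rule Suc.prems(1))
    then show ?thesis by (rule differentiableI)
  qed
  have "partial_deriv v f x = partial_deriv v g x" if "x \<in> S" for v x
    unfolding partial_deriv_def
    using frechet_derivative_transform_within_open[OF _ assms(1) that, of f g] Suc.prems that
    by simp
  then have "Ck_on n (partial_deriv v g) S" for v
    using Suc.IH[of "partial_deriv v f" "partial_deriv v g"] Suc.prems(2) by auto
  with diff show ?case by simp
qed

lemma Ck_on_SucD: "Ck_on (Suc n) f S \<Longrightarrow> Ck_on n f S"
proof (induction n arbitrary: f)
  case 0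
  then show ?case
    by (simp add: differentiable_at_imp_differentiable_on differentiable_imp_continuous_on)
next
  case (Suc n)
  then show ?case by (simp only: Ck_on.simps(2)) blast
qed

lemma partial_deriv_eqI:
  "(f has_derivative f') (at x) \<Longrightarrow> partial_deriv v f x = f' v"
  unfolding partial_deriv_def using frechet_derivative_at by metis

text \<open>Reduces each closure property below to exhibiting a derivative formula. The arbitrary
  choice inside \<open>partial_deriv\<close> is resolved here once, by uniqueness of the
  derivative.\<close>

lemma Ck_on_SucI:
  fixes f :: "'a::euclidean_space \<Rightarrow> real"
  assumes "open S" "\<And>x. x \<in> S \<Longrightarrow> (f has_derivative f' x) (at x)"
    "\<And>v. Ck_on n (\<lambda>x. f' x v) S"
  shows "Ck_on (Suc n) f S"
  unfolding Ck_on.simps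
proof (intro conjI ballI allI)
  show "f differentiable (at x)" if "x \<in> S" for x
    using assms(2)[OF that] by (rule differentiableI)
  show "Ck_on n (partial_deriv v f) S" for v
    by (rule Ck_on_cong[OF assms(1) _ assms(3)[of v]])
      (simp add: partial_deriv_eqI[OF assms(2)])
qed

lemma Ck_on_has_derivative:
  assumes "Ck_on (Suc n) f S" "x \<in> S"
  shows "(f has_derivative (\<lambda>v. partial_deriv v f x)) (at x)"
  using assms frechet_derivative_works[of f "at x"] by (simp add: partial_deriv_def)

lemma Ck_on_const: "open S \<Longrightarrow> Ck_on n (\<lambda>x. c) S"
proof (induction n arbitrary: c)
  case (Suc n)
  show ?case
    by (rule Ck_on_SucI[where f' = "\<lambda>x v. 0"]) (use Suc in auto)
qed simp

lemma Ck_on_linear: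
  assumes "open S" "bounded_linear f"
  shows "Ck_on n f S"
proof (cases n)
  case 0
  then show ?thesis using assms(2) by (simp add: linear_continuous_on)
next
  case (Suc n)
  then show ?thesis
    using Ck_on_SucI[of S f "\<lambda>x. f" n] assms Ck_on_const[OF assms(1)]
    by (simp add: bounded_linear.has_derivative[of f "\<lambda>x. x" "\<lambda>x. x"])
qed

lemma Ck_on_add:
  assumes "open S"
  shows "Ck_on n f S \<Longrightarrow> Ck_on n g S \<Longrightarrow> Ck_on n (\<lambda>x. f x + g x) S"
proof (induction n arbitrary: f g)
  case 0
  then show ?case by (simp add: continuous_on_add)
next
  case (Suc n)
  show ?case
    by (rule Ck_on_SucI[OF assms, where f' = "\<lambda>x v. partial_deriv v f x + partial_deriv v g x"])
      (use Suc in \<open>auto intro!: has_derivative_add Ck_on_has_derivative\<close>)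
qed

lemma Ck_on_mult:
  assumes "open S"
  shows "Ck_on n f S \<Longrightarrow> Ck_on n g S \<Longrightarrow> Ck_on n (\<lambda>x. f x * g x) S"
proof (induction n arbitrary: f g)
  case 0
  then show ?case by (simp add: continuous_on_mult)
next
  case (Suc n)
  note f = Ck_on_has_derivative[OF Suc.prems(1)]
  note g = Ck_on_has_derivative[OF Suc.prems(2)]
  \<comment> \<open>The Leibniz formula still contains \<open>f\<close> and \<open>g\<close>
    undifferentiated, so the induction hypothesis needs them at the lower level as well.\<close>
  have "Ck_on n f S" "Ck_on n g S"
    using Suc.prems by (auto dest!: Ck_on_SucD simp del: Ck_on.simps)
  with Suc show ?case
    by (intro Ck_on_SucI[OF assms, where f' = "\<lambda>x v. f x * partial_deriv v g x + partial_deriv v f x * g x"])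
      (auto intro!: has_derivative_mult f g Ck_on_add assms Suc.IH)
qed

text \<open>The chain rule replaces \<open>G j\<close> by \<open>G (Suc j)\<close>, so the induction
  has to carry a whole sequence of successive derivatives with \<open>j\<close> left
  arbitrary.\<close>

lemma Ck_on_compose_real:
  fixes u :: "'a::euclidean_space \<Rightarrow> real" and G :: "nat \<Rightarrow> real \<Rightarrow> real"
  assumes "open S" and G: "\<And>j t. (G j has_real_derivative G (Suc j) t) (at t)"
  shows "Ck_on n u S \<Longrightarrow> Ck_on n (\<lambda>x. G j (u x)) S"
proof (induction n arbitrary: j)
  case 0
  have "continuous_on UNIV (G j)"
    using G by (intro DERIV_continuous_on) (auto intro: has_field_derivative_at_within)
  with 0 show ?case
    by (simp add: continuous_on_compose2)
next
  case (Suc n)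
  show ?case
  proof (rule Ck_on_SucI[OF assms(1), where f' = "\<lambda>x v. partial_deriv v u x * G (Suc j) (u x)"])
    show "((\<lambda>x. G j (u x)) has_derivative (\<lambda>v. partial_deriv v u x * G (Suc j) (u x))) (at x)"
      if "x \<in> S" for x
      using has_derivative_in_compose[OF Ck_on_has_derivative[OF Suc.prems that]
          has_derivative_at_withinI[OF G[of j "u x", unfolded has_field_derivative_def]]]
      by (simp add: mult.commute)
    show "Ck_on n (\<lambda>x. partial_deriv v u x * G (Suc j) (u x)) S" for v
      using Suc.prems Ck_on_SucD[OF Suc.prems]
      by (intro Ck_on_mult assms(1) Suc.IH) auto
  qed
qed

lemma Ck_on_Un:
  assumes "open S" "open T"
  shows "Ck_on n f S \<Longrightarrow> Ck_on n f T \<Longrightarrow> Ck_on n f (S \<union> T)"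
  by (induction n arbitrary: f) (use assms in \<open>auto intro: continuous_on_open_Un\<close>)

lemma Ck_on_subset: "Ck_on n f S \<Longrightarrow> T \<subseteq> S \<Longrightarrow> Ck_on n f T"
  by (induction n arbitrary: f) (auto intro: continuous_on_subset)

lemma smooth_on_partial_deriv: "smooth_on S f \<Longrightarrow> smooth_on S (partial_deriv v f)"
  unfolding smooth_on_def by (metis Ck_on.simps(2))

lemma smooth_on_iter_partial: "smooth_on S f \<Longrightarrow> smooth_on S (iter_partial bs f)"
  by (induction bs) (auto simp: iter_partial_def intro: smooth_on_partial_deriv)

lemma smooth_on_imp_continuous_on: "smooth_on S f \<Longrightarrow> continuous_on S f"
  unfolding smooth_on_def by (metis Ck_on.simps(1))

lemma smooth_on_has_derivative:
  "smooth_on S f \<Longrightarrow> x \<in> S \<Longrightarrow> (f has_derivative (\<lambda>v. partial_deriv v f x)) (at x)"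
  unfolding smooth_on_def using Ck_on_has_derivative by blast

lemma smooth_on_mult:
  "open S \<Longrightarrow> smooth_on S f \<Longrightarrow> smooth_on S g \<Longrightarrow> smooth_on S (\<lambda>x. f x * g x)"
  by (simp add: smooth_on_def Ck_on_mult)

lemma smooth_on_add:
  "open S \<Longrightarrow> smooth_on S f \<Longrightarrow> smooth_on S g \<Longrightarrow> smooth_on S (\<lambda>x. f x + g x)"
  by (simp add: smooth_on_def Ck_on_add)

lemma smooth_on_const: "open S \<Longrightarrow> smooth_on S (\<lambda>x. c)"
  by (simp add: smooth_on_def Ck_on_const)

lemma smooth_on_linear: "open S \<Longrightarrow> bounded_linear f \<Longrightarrow> smooth_on S f"
  by (simp add: smooth_on_def Ck_on_linear)

lemma smooth_on_diff:
  assumes "open S" "smooth_on S f" "smooth_on S g"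
  shows "smooth_on S (\<lambda>x. f x - g x)"
  using smooth_on_add[OF assms(1,2) smooth_on_mult[OF assms(1) smooth_on_const[OF assms(1), of "-1"] assms(3)]]
  by simp

lemma smooth_on_prod:
  assumes "open S" "finite A" "\<And>i. i \<in> A \<Longrightarrow> smooth_on S (f i)"
  shows "smooth_on S (\<lambda>x. \<Prod>i\<in>A. f i x)"
  using assms(2,3)
  by (induction A rule: finite_induct) (simp_all add: smooth_on_const smooth_on_mult assms(1))

lemma smooth_on_subset: "smooth_on S f \<Longrightarrow> T \<subseteq> S \<Longrightarrow> smooth_on T f"
  unfolding smooth_on_def using Ck_on_subset by blast

text \<open>\<open>exp_recip p\<close> is the smooth extension of \<open>p(1/t) exp(-1/t)\<close> by zero from \<open>t > 0\<close> to the line;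
  the family is closed under differentiation.\<close>

definition exp_recip :: "real poly \<Rightarrow> real \<Rightarrow> real" where
  "exp_recip p t = (if t > 0 then poly p (1 / t) * exp (- (1 / t)) else 0)"

text \<open>With y = 1/t one has dy/dt = -y^2, hence the t-derivative of p(y) exp(-y) is y^2 (p -
  p')(y) exp(-y).\<close>

definition exp_recip_step :: "real poly \<Rightarrow> real poly" where
  "exp_recip_step p = [:0, 0, 1:] * (p - pderiv p)"

abbreviation bump :: "real \<Rightarrow> real" where
  "bump \<equiv> exp_recip 1"

lemma poly_times_exp_minus_tendsto_0:
  fixes p :: "real poly"
  shows "((\<lambda>y. poly p y * exp (- y)) \<longlongrightarrow> 0) at_top"
proof -
  have "((\<lambda>y. \<Sum>i\<le>degree p. coeff p i * (y ^ i / exp y)) \<longlongrightarrow> (\<Sum>i\<le>degree p. coeff p i * 0)) at_top"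
    by (intro tendsto_sum tendsto_mult tendsto_const tendsto_power_div_exp_0)
  then show ?thesis
    by (simp add: poly_altdef exp_minus sum_distrib_right divide_inverse mult.assoc)
qed

lemma exp_recip_has_derivative:
  "(exp_recip p has_real_derivative exp_recip (exp_recip_step p) t) (at t)"
proof -
  consider "t > 0" | "t < 0" | "t = 0" by linarith
  then show ?thesis
  proof cases
    case 1
    have "((\<lambda>t. 1 / t) has_real_derivative - (1 / t)\<^sup>2) (at t)"
      using DERIV_inverse[of t] 1 by (simp add: inverse_eq_divide power_divide numeral_2_eq_2)
    note d = DERIV_mult[OF DERIV_chain2[OF poly_DERIV[of p] this]
        DERIV_chain2[OF DERIV_exp DERIV_minus[OF this]]]
    have "((\<lambda>t. poly p (1 / t) * exp (- (1 / t))) has_real_derivative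
       exp_recip (exp_recip_step p) t) (at t)"
      by (rule DERIV_cong[OF d])
        (use 1 in \<open>simp add: exp_recip_def exp_recip_step_def algebra_simps power2_eq_square\<close>)
    then show ?thesis
      by (rule has_field_derivative_transform_within_open[where S = "{0<..}"])
        (use 1 in \<open>auto simp: exp_recip_def\<close>)
  next
    case 2
    have "((\<lambda>t. 0) has_real_derivative exp_recip (exp_recip_step p) t) (at t)"
      using 2 by (simp add: exp_recip_def)
    then show ?thesis
      by (rule has_field_derivative_transform_within_open[where S = "{..<0}"])
        (use 2 in \<open>auto simp: exp_recip_def\<close>)
  next
    case 3
    have "((\<lambda>h. exp_recip p h / h) \<longlongrightarrow> 0) (at_right 0)"
    proof -
      \<comment> \<open>The difference quotient at 0 stays in the family: dividing by h multiplies
        the polynomial by y = 1/h, and the exponential wins as y grows.\<close>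
      have "((\<lambda>h. poly (pCons 0 p) (inverse h) * exp (- (inverse h))) \<longlongrightarrow> 0) (at_right 0)"
        by (rule filterlim_compose[OF poly_times_exp_minus_tendsto_0 filterlim_inverse_at_top_right])
      moreover have "\<forall>\<^sub>F h in at_right 0.
          poly (pCons 0 p) (inverse h) * exp (- (inverse h)) = exp_recip p h / h"
        unfolding eventually_at_right_field
        by (rule exI[of _ 1]) (simp add: exp_recip_def field_simps)
      ultimately show ?thesis
        by (rule Lim_transform_eventually)
    qed
    moreover have "((\<lambda>h. exp_recip p h / h) \<longlongrightarrow> 0) (at_left 0)"
    proof -
      have "\<forall>\<^sub>F h in at_left 0. (0::real) = exp_recip p h / h"
        unfolding eventually_at_left_field
        by (rule exI[of _ "-1"]) (simp add: exp_recip_def)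
      then show ?thesis
        by (rule Lim_transform_eventually[OF tendsto_const])
    qed
    ultimately have "((\<lambda>h. exp_recip p h / h) \<longlongrightarrow> 0) (at 0)"
      by (simp add: filterlim_at_split)
    then show ?thesis
      using 3 by (simp add: DERIV_def exp_recip_def)
  qed
qed

lemma bump_nonneg: "bump t \<ge> 0" and bump_le_1: "bump t \<le> 1"
  and bump_eq_0: "t \<le> 0 \<Longrightarrow> bump t = 0"
  by (auto simp: exp_recip_def)

lemma smooth_on_exp_recip:
  assumes "open S" "smooth_on S u"
  shows "smooth_on S (\<lambda>x. exp_recip p (u x))"
  using Ck_on_compose_real[OF assms(1), of "\<lambda>j. exp_recip ((exp_recip_step ^^ j) p)" _ u 0]
    assms(2) exp_recip_has_derivative
  by (simp add: smooth_on_def)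

text \<open>Since \<open>bump\<close> tends to 1, scaling its argument by \<open>n\<close> gives
  smooth approximations of the indicator of the positive half-line. For other polynomials the limit
  controls the derivative of the cutoff.\<close>

lemma exp_recip_tendsto: "(exp_recip p \<longlongrightarrow> poly p 0) at_top"
proof -
  have "((\<lambda>t::real. poly p (inverse t) * exp (- inverse t)) \<longlongrightarrow> poly p 0 * exp (- 0)) at_top"
    by (intro tendsto_mult tendsto_poly tendsto_exp tendsto_minus tendsto_inverse_0_at_top filterlim_ident)
  moreover have "\<forall>\<^sub>F t in at_top. poly p (inverse t) * exp (- inverse t) = exp_recip p t"
    using eventually_gt_at_top[of 0]
    by eventually_elim (simp add: exp_recip_def divide_inverse)
  ultimately show ?thesis
    by (simp add: tendsto_cong)
qed

section \<open>Integration by parts against test functions\<close>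

lemma test_functionsI:
  assumes "smooth_on UNIV \<phi>" "compact K" "K \<subseteq> \<Omega>" "\<And>x. x \<notin> K \<Longrightarrow> \<phi> x = 0"
  shows "\<phi> \<in> test_functions \<Omega>"
proof -
  have "closure {x. \<phi> x \<noteq> 0} \<subseteq> K"
    using assms(2,4) by (intro closure_minimal compact_imp_closed) auto
  moreover from this have "compact (closure {x. \<phi> x \<noteq> 0})"
    using assms(2) by (metis closed_Int_compact closed_closure inf.absorb_iff1)
  ultimately show ?thesis
    using assms by (auto simp: test_functions_def)
qed

lemma test_functionsE:
  assumes "\<phi> \<in> test_functions \<Omega>"
  obtains K where "compact K" "K \<subseteq> \<Omega>" "\<And>x. x \<notin> K \<Longrightarrow> \<phi> x = 0"
proof (rule that)
  show "compact (closure {x. \<phi> x \<noteq> 0})" "closure {x. \<phi> x \<noteq> 0} \<subseteq> \<Omega>"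
    using assms by (auto simp: test_functions_def)
  show "\<phi> x = 0" if "x \<notin> closure {x. \<phi> x \<noteq> 0}" for x
    using that closure_subset[of "{x. \<phi> x \<noteq> 0}"] by blast
qed

lemma test_functions_smooth: "\<phi> \<in> test_functions \<Omega> \<Longrightarrow> smooth_on S \<phi>"
  by (auto simp: test_functions_def intro: smooth_on_subset)

text \<open>The open sets \<open>\<Omega>\<close> and \<open>- K\<close> cover the space. On the
  first the extension is \<open>u\<close>, on the second it is 0, so smoothness is checked on each
  separately.\<close>

lemma extend_by_zero_in_test_functions:
  fixes u :: "'a::euclidean_space \<Rightarrow> real"
  assumes "open \<Omega>" "smooth_on \<Omega> u" "compact K" "K \<subseteq> \<Omega>" "\<And>x. x \<in> \<Omega> \<Longrightarrow> x \<notin> K \<Longrightarrow> u x = 0"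
  shows "(\<lambda>x. if x \<in> \<Omega> then u x else 0) \<in> test_functions \<Omega>" (is "?e \<in> _")
proof (rule test_functionsI[OF _ assms(3,4)])
  have o: "open (- K)" using assms(3) by (intro open_Compl compact_imp_closed)
  have "Ck_on n ?e \<Omega>" for n
    by (rule Ck_on_cong[OF assms(1), of u]) (use assms(2) in \<open>auto simp: smooth_on_def\<close>)
  moreover have "Ck_on n ?e (- K)" for n
    by (rule Ck_on_cong[OF o, of "\<lambda>x. 0"]) (use assms(5) o in \<open>auto simp: Ck_on_const\<close>)
  ultimately have "Ck_on n ?e (\<Omega> \<union> - K)" for n
    by (intro Ck_on_Un assms(1) o)
  moreover have "\<Omega> \<union> - K = UNIV" using assms(4) by auto
  ultimately show "smooth_on UNIV ?e" by (simp add: smooth_on_def)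
qed (use assms in auto)

lemma test_functions_partial_deriv:
  assumes "\<phi> \<in> test_functions \<Omega>"
  shows "partial_deriv v \<phi> \<in> test_functions \<Omega>"
proof -
  obtain K where K: "compact K" "K \<subseteq> \<Omega>" "\<And>x. x \<notin> K \<Longrightarrow> \<phi> x = 0"
    using test_functionsE[OF assms] by blast
  have "partial_deriv v \<phi> x = 0" if "x \<notin> K" for x
  proof -
    have "(\<phi> has_derivative (\<lambda>v. 0)) (at x)"
      by (rule has_derivative_transform_within_open[of "\<lambda>x. 0" _ _ UNIV "- K"])
        (use K that in \<open>auto intro!: open_Compl compact_imp_closed\<close>)
    then show ?thesis by (rule partial_deriv_eqI)
  qed
  then show ?thesis
    using K test_functions_smooth[OF assms]
    by (intro test_functionsI[of _ K]) (auto intro: smooth_on_partial_deriv)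
qed

lemma test_functions_iter_partial:
  "\<phi> \<in> test_functions \<Omega> \<Longrightarrow> iter_partial bs \<phi> \<in> test_functions \<Omega>"
  by (induction bs) (auto simp: iter_partial_def intro: test_functions_partial_deriv)

lemma test_functions_diff:
  assumes "\<phi> \<in> test_functions \<Omega>" "\<psi> \<in> test_functions \<Omega>"
  shows "(\<lambda>x. \<phi> x - \<psi> x) \<in> test_functions \<Omega>"
proof -
  obtain K where K: "compact K" "K \<subseteq> \<Omega>" "\<And>x. x \<notin> K \<Longrightarrow> \<phi> x = 0"
    using test_functionsE[OF assms(1)] by blast
  obtain L where L: "compact L" "L \<subseteq> \<Omega>" "\<And>x. x \<notin> L \<Longrightarrow> \<psi> x = 0"
    using test_functionsE[OF assms(2)] by blast
  show ?thesis
    by (rule test_functionsI[of _ "K \<union> L"])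
      (use K L in \<open>auto intro: smooth_on_diff test_functions_smooth[OF assms(1)] test_functions_smooth[OF assms(2)]\<close>)
qed

lemma test_functions_continuous: "\<phi> \<in> test_functions \<Omega> \<Longrightarrow> continuous_on S \<phi>"
  using smooth_on_imp_continuous_on test_functions_smooth by blast

lemma test_functions_measurable: "\<phi> \<in> test_functions \<Omega> \<Longrightarrow> \<phi> \<in> borel_measurable borel"
  using test_functions_continuous by (intro borel_measurable_continuous_onI)

lemma test_functions_integrable:
  fixes \<phi> :: "'a::euclidean_space \<Rightarrow> real"
  assumes "\<phi> \<in> test_functions \<Omega>"
  shows "integrable lborel \<phi>"
proof -
  obtain K where K: "compact K" "K \<subseteq> \<Omega>" "\<And>x. x \<notin> K \<Longrightarrow> \<phi> x = 0"
    using test_functionsE[OF assms] by blast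
  have "integrable lborel (\<lambda>x. indicator K x *\<^sub>R \<phi> x)"
    using K(1) test_functions_continuous[OF assms] by (rule borel_integrable_compact)
  moreover have "(\<lambda>x. indicator K x *\<^sub>R \<phi> x) = \<phi>"
    by (rule ext) (use K(3) in \<open>auto simp: indicator_def\<close>)
  ultimately show ?thesis by simp
qed

lemma test_functions_bounded:
  fixes \<phi> :: "'a::euclidean_space \<Rightarrow> real"
  assumes "\<phi> \<in> test_functions \<Omega>"
  obtains M where "M \<ge> 0" "\<And>x. \<bar>\<phi> x\<bar> \<le> M"
proof -
  obtain K where K: "compact K" "K \<subseteq> \<Omega>" "\<And>x. x \<notin> K \<Longrightarrow> \<phi> x = 0"
    using test_functionsE[OF assms] by blast
  have "bounded (\<phi> ` K)"
    using K(1) test_functions_continuous[OF assms]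
    by (intro compact_imp_bounded compact_continuous_image)
  then obtain M where M: "\<And>x. x \<in> K \<Longrightarrow> \<bar>\<phi> x\<bar> \<le> M"
    by (auto simp: bounded_iff)
  have "\<bar>\<phi> x\<bar> \<le> max M 0" for x
    using M[of x] K(3)[of x] by (cases "x \<in> K") auto
  then show ?thesis by (rule that[rotated]) auto
qed

text \<open>By translation invariance the difference quotients have integral zero.\<close>

lemma integral_partial_deriv_test_function:
  fixes \<phi> :: "'a::euclidean_space \<Rightarrow> real"
  assumes "\<phi> \<in> test_functions \<Omega>"
  shows "integral\<^sup>L lborel (partial_deriv b \<phi>) = 0"
proof -
  let ?t = "\<lambda>n. 1 / real (Suc n)"
  define q where "q = (\<lambda>n x. (\<phi> (?t n *\<^sub>R b + x) - \<phi> x) / ?t n)"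
  note \<phi>[measurable] = test_functions_measurable[OF assms]
  note d\<phi>[measurable] = test_functions_measurable[OF test_functions_partial_deriv[OF assms, of b]]
  note int\<phi> = test_functions_integrable[OF assms]
  obtain K where K: "compact K" "K \<subseteq> \<Omega>" "\<And>x. x \<notin> K \<Longrightarrow> \<phi> x = 0"
    using test_functionsE[OF assms] by blast
  obtain R where R: "\<And>x. x \<in> K \<Longrightarrow> norm x \<le> R"
    using compact_imp_bounded[OF K(1)] by (auto simp: bounded_iff)
  obtain M where M: "M \<ge> 0" "\<And>x. \<bar>partial_deriv b \<phi> x\<bar> \<le> M"
    using test_functions_bounded[OF test_functions_partial_deriv[OF assms, of b]] by blast
  have deriv: "((\<lambda>s. \<phi> (s *\<^sub>R b + x)) has_real_derivative partial_deriv b \<phi> (s *\<^sub>R b + x)) (at s)" for s x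
  proof -
    have h: "(\<phi> has_derivative (\<lambda>v. partial_deriv v \<phi> (s *\<^sub>R b + x))) (at (s *\<^sub>R b + x))"
      using smooth_on_has_derivative test_functions_smooth[OF assms] by blast
    have "((\<lambda>s. s *\<^sub>R b + x) has_derivative (\<lambda>r. r *\<^sub>R b)) (at s)"
      by (auto intro!: derivative_eq_intros)
    from has_derivative_compose[OF this h]
    have "((\<lambda>s. \<phi> (s *\<^sub>R b + x)) has_derivative (\<lambda>r. partial_deriv (r *\<^sub>R b) \<phi> (s *\<^sub>R b + x))) (at s)" .
    moreover have "partial_deriv (r *\<^sub>R b) \<phi> (s *\<^sub>R b + x) = partial_deriv b \<phi> (s *\<^sub>R b + x) * r" for r
      using linear_scale[OF has_derivative_linear[OF h], of r b] by (simp add: mult.commute)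
    ultimately show ?thesis
      by (simp add: has_field_derivative_def)
  qed
  have shift: "has_bochner_integral lborel (\<lambda>x. \<phi> (c + x)) (integral\<^sup>L lborel \<phi>)" for c
  proof -
    have "has_bochner_integral (distr lborel borel ((+) c)) \<phi> (integral\<^sup>L lborel \<phi>)"
      using int\<phi> by (simp add: lborel_distr_plus has_bochner_integral_integrable)
    then show ?thesis
      by (simp add: has_bochner_integral_iff integrable_distr_eq integral_distr)
  qed
  have "integral\<^sup>L lborel (q n) = 0" for n
    using shift[of "?t n *\<^sub>R b"] int\<phi>
    by (simp add: q_def has_bochner_integral_iff)
  moreover have "(\<lambda>n. integral\<^sup>L lborel (q n)) \<longlonglongrightarrow> integral\<^sup>L lborel (partial_deriv b \<phi>)"
  \<comment> \<open>By the mean value theorem the quotients are bounded by the bound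
    \<open>M\<close> of the derivative. The steps \<open>?t n\<close> are at most 1, so a translate
    moves the support, which lies in the ball of radius \<open>R\<close>, by at most
    \<open>norm b\<close>.\<close>
  proof (rule integral_dominated_convergence[where w = "\<lambda>x. indicator (cball 0 (R + norm b)) x *\<^sub>R M"])
    show "integrable lborel (\<lambda>x. indicator (cball 0 (R + norm b)) x *\<^sub>R M)"
      by (rule borel_integrable_compact) auto
    have "(\<lambda>n. q n x) \<longlonglongrightarrow> partial_deriv b \<phi> x" for x
    proof -
      have "((\<lambda>h. (\<phi> ((0 + h) *\<^sub>R b + x) - \<phi> (0 *\<^sub>R b + x)) / h) \<longlongrightarrow> partial_deriv b \<phi> (0 *\<^sub>R b + x)) (at 0)"
        using deriv[of x 0] by (simp only: DERIV_def)
      moreover have "filterlim ?t (at 0) sequentially"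
        using LIMSEQ_inverse_real_of_nat
        by (auto simp: filterlim_at inverse_eq_divide)
      ultimately have "(\<lambda>n. (\<phi> ((0 + ?t n) *\<^sub>R b + x) - \<phi> (0 *\<^sub>R b + x)) / ?t n)
          \<longlonglongrightarrow> partial_deriv b \<phi> (0 *\<^sub>R b + x)"
        by (rule filterlim_compose)
      then show ?thesis by (simp add: q_def)
    qed
    then show "AE x in lborel. (\<lambda>n. q n x) \<longlonglongrightarrow> partial_deriv b \<phi> x" by simp
    have "norm (q n x) \<le> indicator (cball 0 (R + norm b)) x *\<^sub>R M" for n x
    proof (cases "x \<in> cball 0 (R + norm b)")
      case True
      obtain z where "\<phi> (?t n *\<^sub>R b + x) - \<phi> (0 *\<^sub>R b + x) = (?t n - 0) * partial_deriv b \<phi> (z *\<^sub>R b + x)"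
        using MVT2[of 0 "?t n" "\<lambda>s. \<phi> (s *\<^sub>R b + x)" "\<lambda>s. partial_deriv b \<phi> (s *\<^sub>R b + x)"] deriv
        by auto
      then have "q n x = partial_deriv b \<phi> (z *\<^sub>R b + x)"
        by (simp add: q_def)
      then show ?thesis using M True by simp
    next
      case False
      have "norm (?t n *\<^sub>R b) \<le> 1 * norm b"
        unfolding norm_scaleR by (intro mult_right_mono) auto
      then have "norm x - norm b \<le> norm (?t n *\<^sub>R b + x)"
        using norm_triangle_ineq2[of x "- (?t n *\<^sub>R b)"] by (simp add: add.commute)
      then have "\<not> norm (?t n *\<^sub>R b + x) \<le> R" "\<not> norm x \<le> R"
        using False norm_ge_zero[of b] by (auto simp: not_le simp del: norm_ge_zero)
      then have "\<phi> (?t n *\<^sub>R b + x) = 0" "\<phi> x = 0"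
        using R K(3) by blast+
      then show ?thesis using False by (simp add: q_def)
    qed
    then show "AE x in lborel. norm (q n x) \<le> indicator (cball 0 (R + norm b)) x *\<^sub>R M" for n by simp
  qed (simp_all add: q_def)
  ultimately show ?thesis
    by (simp add: LIMSEQ_const_iff)
qed

lemma open_sets_lebesgue: "open S \<Longrightarrow> S \<in> sets lebesgue"
  by auto

text \<open>Weak derivatives are defined by integrals over \<open>\<Omega>\<close>, whereas
  translation invariance lives on the whole space; the compact support reconciles the two.\<close>

lemma has_bochner_integral_test_function_restrict:
  fixes \<phi> :: "'a::euclidean_space \<Rightarrow> real"
  assumes "open \<Omega>" "\<phi> \<in> test_functions \<Omega>"
  shows "has_bochner_integral (lebesgue_on \<Omega>) \<phi> (integral\<^sup>L lborel \<phi>)"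
proof -
  obtain K where K: "compact K" "K \<subseteq> \<Omega>" "\<And>x. x \<notin> K \<Longrightarrow> \<phi> x = 0"
    using test_functionsE[OF assms(2)] by blast
  have "(\<lambda>x. if x \<in> \<Omega> then \<phi> x else 0) = \<phi>"
    by (rule ext) (use K in auto)
  then show ?thesis
    using Lebesgue_Measure.integral_restrict_UNIV[OF open_sets_lebesgue[OF assms(1)], of \<phi>]
      Lebesgue_Measure.integrable_restrict_UNIV[OF open_sets_lebesgue[OF assms(1)], of \<phi>]
      test_functions_measurable[OF assms(2)] test_functions_integrable[OF assms(2)]
    by (simp add: has_bochner_integral_iff integral_completion integrable_completion)
qed

text \<open>\<open>u\<close> may be uncontrolled near the boundary, but the support of
  \<open>\<phi>\<close> keeps the product away from it. This allows integration by parts without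
  boundary terms.\<close>

lemma smooth_times_test_function:
  fixes u :: "'a::euclidean_space \<Rightarrow> real"
  assumes "open \<Omega>" "smooth_on \<Omega> u" "\<phi> \<in> test_functions \<Omega>"
  shows "(\<lambda>x. if x \<in> \<Omega> then u x * \<phi> x else 0) \<in> test_functions \<Omega>"
proof -
  obtain K where K: "compact K" "K \<subseteq> \<Omega>" "\<And>x. x \<notin> K \<Longrightarrow> \<phi> x = 0"
    using test_functionsE[OF assms(3)] by blast
  show ?thesis
    by (rule extend_by_zero_in_test_functions[OF assms(1) _ K(1,2)])
      (use assms K in \<open>auto intro: smooth_on_mult test_functions_smooth\<close>)
qed

lemma integrable_smooth_times_test_function:
  fixes u :: "'a::euclidean_space \<Rightarrow> real"
  assumes "open \<Omega>" "smooth_on \<Omega> u" "\<phi> \<in> test_functions \<Omega>"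
  shows "integrable (lebesgue_on \<Omega>) (\<lambda>x. u x * \<phi> x)"
proof -
  have "integrable (lebesgue_on \<Omega>) (\<lambda>x. if x \<in> \<Omega> then u x * \<phi> x else 0)"
    using has_bochner_integral_test_function_restrict[OF assms(1) smooth_times_test_function[OF assms]]
    by (simp add: has_bochner_integral_iff)
  then show ?thesis
    by (rule Bochner_Integration.integrable_cong[THEN iffD1, rotated -1]) auto
qed

text \<open>The product extended by zero is a test function, so its derivative has integral zero;
  the product rule splits that integral into the two sides.\<close>

lemma integral_by_parts_test_function:
  fixes u :: "'a::euclidean_space \<Rightarrow> real"
  assumes "open \<Omega>" "smooth_on \<Omega> u" "\<phi> \<in> test_functions \<Omega>"
  shows "(LINT x|lebesgue_on \<Omega>. u x * partial_deriv b \<phi> x) =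
    - (LINT x|lebesgue_on \<Omega>. partial_deriv b u x * \<phi> x)"
proof -
  let ?\<psi> = "\<lambda>x. if x \<in> \<Omega> then u x * \<phi> x else 0"
  have \<psi>: "?\<psi> \<in> test_functions \<Omega>"
    using assms by (rule smooth_times_test_function)
  have eq: "partial_deriv b ?\<psi> x = u x * partial_deriv b \<phi> x + partial_deriv b u x * \<phi> x"
    if "x \<in> \<Omega>" for x
  proof -
    have "((\<lambda>x. u x * \<phi> x) has_derivative
        (\<lambda>v. u x * partial_deriv v \<phi> x + partial_deriv v u x * \<phi> x)) (at x)"
      using smooth_on_has_derivative[OF assms(2) that]
        smooth_on_has_derivative[OF test_functions_smooth[OF assms(3)] that]
      by (rule has_derivative_mult)
    then have "(?\<psi> has_derivative
        (\<lambda>v. u x * partial_deriv v \<phi> x + partial_deriv v u x * \<phi> x)) (at x)"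
      by (rule has_derivative_transform_within_open[OF _ assms(1) that]) simp
    then show ?thesis by (rule partial_deriv_eqI)
  qed
  have "0 = integral\<^sup>L lborel (partial_deriv b ?\<psi>)"
    using integral_partial_deriv_test_function[OF \<psi>] by simp
  also have "\<dots> = (LINT x|lebesgue_on \<Omega>. partial_deriv b ?\<psi> x)"
    using has_bochner_integral_test_function_restrict[OF assms(1) test_functions_partial_deriv[OF \<psi>]]
    by (simp add: has_bochner_integral_iff)
  also have "\<dots> = (LINT x|lebesgue_on \<Omega>. u x * partial_deriv b \<phi> x + partial_deriv b u x * \<phi> x)"
    by (rule Bochner_Integration.integral_cong) (simp_all add: eq)
  also have "\<dots> = (LINT x|lebesgue_on \<Omega>. u x * partial_deriv b \<phi> x) +
      (LINT x|lebesgue_on \<Omega>. partial_deriv b u x * \<phi> x)"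
    using assms
    by (intro Bochner_Integration.integral_add integrable_smooth_times_test_function
        smooth_on_partial_deriv test_functions_partial_deriv)
  finally show ?thesis by simp
qed

text \<open>The outermost derivative of \<open>\<phi>\<close> is moved first and becomes the
  innermost derivative of \<open>u\<close>; hence the reversed list.\<close>

lemma integral_by_parts_iter_partial:
  fixes u :: "'a::euclidean_space \<Rightarrow> real"
  assumes "open \<Omega>" "\<phi> \<in> test_functions \<Omega>"
  shows "smooth_on \<Omega> u \<Longrightarrow> (LINT x|lebesgue_on \<Omega>. u x * iter_partial bs \<phi> x) =
    (- 1) ^ length bs * (LINT x|lebesgue_on \<Omega>. iter_partial (rev bs) u x * \<phi> x)"
proof (induction bs arbitrary: u)
  case Nil
  then show ?case by (simp add: iter_partial_def)
next
  case (Cons b bs)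
  have "(LINT x|lebesgue_on \<Omega>. u x * iter_partial (b # bs) \<phi> x) =
      (LINT x|lebesgue_on \<Omega>. u x * partial_deriv b (iter_partial bs \<phi>) x)"
    by (simp add: iter_partial_def)
  also have "\<dots> = - (LINT x|lebesgue_on \<Omega>. partial_deriv b u x * iter_partial bs \<phi> x)"
    by (intro integral_by_parts_test_function assms Cons.prems test_functions_iter_partial)
  also have "\<dots> = (- 1) ^ length (b # bs) *
      (LINT x|lebesgue_on \<Omega>. iter_partial (rev bs) (partial_deriv b u) x * \<phi> x)"
    using Cons.IH[OF smooth_on_partial_deriv[OF Cons.prems, of b]] by simp
  also have "iter_partial (rev bs) (partial_deriv b u) = iter_partial (rev (b # bs)) u"
    by (simp add: iter_partial_def)
  finally show ?case .
qed

text \<open>The list is left existential because \<open>multi_partial\<close> differentiates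
  \<open>\<phi>\<close> in an unspecified order, and the derivative of \<open>u\<close> comes out in
  the reverse of that order.\<close>

lemma smooth_on_has_weak_deriv:
  fixes u :: "'a::euclidean_space \<Rightarrow> real"
  assumes "open \<Omega>" "smooth_on \<Omega> u"
  shows "\<exists>bs. mset bs = \<alpha> \<and> has_weak_deriv \<Omega> \<alpha> u (iter_partial bs u)"
proof -
  define bs where "bs = (SOME bs. mset bs = \<alpha>)"
  have bs: "mset bs = \<alpha>"
    unfolding bs_def by (rule someI_ex) (rule ex_mset)
  have "has_weak_deriv \<Omega> \<alpha> u (iter_partial (rev bs) u)"
    unfolding has_weak_deriv_def multi_partial_def bs_def[symmetric]
    using integral_by_parts_iter_partial[OF assms(1) _ assms(2), of _ bs] bs by auto
  then show ?thesis using bs by (intro exI[of _ "rev bs"]) simp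
qed

lemma smooth_on_has_weak_deriv_single:
  fixes u :: "'a::euclidean_space \<Rightarrow> real"
  assumes "open \<Omega>" "smooth_on \<Omega> u"
  shows "has_weak_deriv \<Omega> {#b#} u (partial_deriv b u)"
  using smooth_on_has_weak_deriv[OF assms, of "{#b#}"] by (auto simp: iter_partial_def)

lemma multi_partial_single: "multi_partial {#b#} \<phi> = partial_deriv b \<phi>"
  and multi_partial_empty: "multi_partial {#} \<phi> = \<phi>"
  by (simp_all add: multi_partial_def iter_partial_def)

lemma has_weak_deriv_empty: "has_weak_deriv \<Omega> {#} u u"
  by (simp add: has_weak_deriv_def multi_partial_empty)

section \<open>Uniqueness of weak derivatives\<close>

text \<open>Boxes exhaust the space. The total integral is what the step to complements in the next
  lemma relies on.\<close>

lemma integral_eq_0_if_boxes: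
  fixes f :: "'a::euclidean_space \<Rightarrow> real"
  assumes f: "integrable lborel f" and box: "\<And>a b. (LINT x:box a b|lborel. f x) = 0"
  shows "integral\<^sup>L lborel f = 0"
proof -
  let ?B = "\<lambda>n::nat. box (- (real n *\<^sub>R One)) (real n *\<^sub>R One) :: 'a set"
  have "(\<lambda>n. LINT x|lborel. indicator (?B n) x *\<^sub>R f x) \<longlonglongrightarrow> (LINT x|lborel. f x)"
  proof (rule integral_dominated_convergence[where w = "\<lambda>x. \<bar>f x\<bar>"])
    have "(\<lambda>n. indicator (?B n) x *\<^sub>R f x) \<longlonglongrightarrow> f x" for x
    proof (rule tendsto_eventually)
      obtain N where N: "x \<in> ?B N"
        using UN_box_eq_UNIV[where 'a = 'a] by blast
      have "x \<in> ?B n" if "n \<ge> N" for n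
      proof -
        have "real N \<le> real n" using that by simp
        then show ?thesis using N by (fastforce simp: mem_box)
      qed
      then show "\<forall>\<^sub>F n in sequentially. indicator (?B n) x *\<^sub>R f x = f x"
        by (auto simp: eventually_sequentially intro!: exI[of _ N])
    qed
    then show "AE x in lborel. (\<lambda>n. indicator (?B n) x *\<^sub>R f x) \<longlonglongrightarrow> f x" by simp
    show "AE x in lborel. norm (indicator (?B n) x *\<^sub>R f x) \<le> \<bar>f x\<bar>" for n
      by (simp add: indicator_def)
  qed (use f in \<open>auto intro!: borel_measurable_scaleR\<close>)
  moreover have "(LINT x|lborel. indicator (?B n) x *\<^sub>R f x) = 0" for n
    using box unfolding set_lebesgue_integral_def .
  ultimately show ?thesis by (simp add: LIMSEQ_const_iff)
qed

text \<open>A Dynkin argument: boxes are stable under intersection and generate the Borel sets, so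
  the integral of \<open>f\<close> vanishes over every Borel set, which forces \<open>f\<close> to
  be zero almost everywhere.\<close>

lemma AE_lborel_eq_0_if_boxes:
  fixes f :: "'a::euclidean_space \<Rightarrow> real"
  assumes f: "integrable lborel f" and box: "\<And>a b. (LINT x:box a b|lborel. f x) = 0"
  shows "AE x in lborel. f x = 0"
proof (rule sigma_finite_measure.density_zero[OF lborel.sigma_finite_measure_axioms f])
  let ?E = "range (\<lambda>(a, b). box a b :: 'a set)"
  have set_int: "set_integrable lborel A f" if "A \<in> sets borel" for A
    using integrable_mult_indicator[of A lborel f] f that by (simp add: set_integrable_def)
  have total: "integral\<^sup>L lborel f = 0"
    using assms by (rule integral_eq_0_if_boxes)
  have E: "sigma_sets UNIV ?E = sets borel"
    by (simp add: borel_eq_box)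
  have stable: "Int_stable ?E"
    by (auto simp: Int_stable_def box_Int_box)
  fix A :: "'a set" assume "A \<in> sets lborel"
  then have "?E \<subseteq> Pow UNIV" "A \<in> sigma_sets UNIV ?E" by (simp_all add: E)
  then show "(LINT x:A|lborel. f x) = 0"
  proof (induction rule: sigma_sets_induct_disjoint[OF stable, consumes 2, case_names basic empty compl union])
    case (basic A)
    then show ?case using box by auto
  next
    case empty
    then show ?case by (simp add: set_lebesgue_integral_def)
  next
    case (compl A)
    then have "A \<in> sets borel" by (simp add: E)
    then have "(LINT x:(UNIV - A) \<union> A|lborel. f x) = (LINT x:UNIV - A|lborel. f x) + (LINT x:A|lborel. f x)"
      by (intro set_integral_Un set_int) auto
    then show ?case using compl total
      by (simp add: Un_absorb2 set_lebesgue_integral_def)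
  next
    case (union A)
    then have A: "A i \<in> sets borel" for i using E by auto
    then have U: "(\<Union>i. A i) \<in> sets borel" by auto
    have "(LINT x:(\<Union>i. A i)|lborel. f x) = (\<Sum>i. LINT x:A i|lborel. f x)"
      using union A set_int[OF U]
      by (intro lebesgue_integral_countable_add) (auto simp: disjoint_family_on_def)
    then show ?case using union by simp
  qed
qed

text \<open>The Dynkin argument takes place on Borel sets, so \<open>f\<close> is first replaced by
  a Borel function equal to it almost everywhere.\<close>

lemma AE_lebesgue_eq_0_if_boxes:
  fixes f :: "'a::euclidean_space \<Rightarrow> real"
  assumes f: "integrable lebesgue f" and box: "\<And>a b. (LINT x:box a b|lebesgue. f x) = 0"
  shows "AE x in lebesgue. f x = 0"
proof -
  obtain f' where f'[measurable]: "f' \<in> borel_measurable lborel" and eq: "AE x in lborel. f x = f' x"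
    using completion_ex_borel_measurable_real[OF borel_measurable_integrable[OF f]] by auto
  have f'_leb: "f' \<in> borel_measurable lebesgue"
    using f' by (rule measurable_completion)
  have eq': "AE x in lebesgue. f x = f' x"
    using eq by (rule AE_completion)
  have "integrable lebesgue f'"
    by (rule integrable_cong_AE_imp[OF f])
      (use f' eq' in \<open>auto intro: measurable_completion elim: eventually_mono\<close>)
  then have "integrable lborel f'"
    using integrable_completion[OF f'] by simp
  moreover have "(LINT x:box a b|lborel. f' x) = 0" for a b
  proof -
    have "(LINT x:box a b|lborel. f' x) = (LINT x:box a b|lebesgue. f' x)"
      unfolding set_lebesgue_integral_def by (rule integral_completion[symmetric]) measurable
    also have "\<dots> = (LINT x:box a b|lebesgue. f x)"
      unfolding set_lebesgue_integral_def
      by (rule integral_cong_AE)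
        (use eq' in \<open>auto intro!: borel_measurable_times borel_measurable_integrable[OF f]
          f'_leb borel_measurable_indicator elim: eventually_mono\<close>)
    finally show ?thesis using box by simp
  qed
  ultimately have "AE x in lborel. f' x = 0"
    by (rule AE_lborel_eq_0_if_boxes)
  then have "AE x in lebesgue. f' x = 0" by (rule AE_completion)
  with eq' show ?thesis by eventually_elim simp
qed

text \<open>Each face of the box contributes one factor that vanishes beyond it. As \<open>n\<close>
  grows, the products approximate the indicator of the open box from below.\<close>

definition box_bump :: "'a::euclidean_space \<Rightarrow> 'a \<Rightarrow> nat \<Rightarrow> 'a \<Rightarrow> real" where
  "box_bump a b n x = (\<Prod>i\<in>Basis. bump (real n * ((x - a) \<bullet> i)) * bump (real n * ((b - x) \<bullet> i)))"

lemma box_bump_in_test_functions: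
  assumes "cbox a b \<subseteq> \<Omega>"
  shows "box_bump a b n \<in> test_functions \<Omega>"
proof (rule test_functionsI)
  have lin: "smooth_on UNIV (\<lambda>x::'a. x \<bullet> i)" for i
    by (intro smooth_on_linear bounded_linear_inner_left) auto
  have "smooth_on UNIV (\<lambda>x::'a. bump (real n * (x \<bullet> i - a \<bullet> i)) * bump (real n * (b \<bullet> i - x \<bullet> i)))" for i
    by (intro smooth_on_mult smooth_on_exp_recip smooth_on_diff smooth_on_const lin) auto
  then show "smooth_on UNIV (box_bump a b n)"
    unfolding box_bump_def[abs_def] inner_diff_left by (intro smooth_on_prod) auto
  show "box_bump a b n x = 0" if "x \<notin> cbox a b" for x
  proof -
    have "\<exists>i\<in>Basis. x \<bullet> i < a \<bullet> i \<or> b \<bullet> i < x \<bullet> i"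
      using that unfolding mem_box by (simp add: not_le)
    then obtain i where i: "i \<in> Basis" "x \<bullet> i < a \<bullet> i \<or> b \<bullet> i < x \<bullet> i"
      by blast
    then have "bump (real n * ((x - a) \<bullet> i)) * bump (real n * ((b - x) \<bullet> i)) = 0"
      by (auto simp: inner_diff_left bump_eq_0 mult_nonneg_nonpos)
    then show ?thesis
      using i(1) unfolding box_bump_def by (intro prod_zero) auto
  qed
qed (use assms in auto)

lemma box_bump_nonneg: "box_bump a b n x \<ge> 0"
  unfolding box_bump_def by (intro prod_nonneg mult_nonneg_nonneg bump_nonneg)

lemma box_bump_le_1: "box_bump a b n x \<le> 1"
  unfolding box_bump_def
  by (intro prod_le_1) (auto intro!: mult_nonneg_nonneg mult_le_one bump_nonneg bump_le_1)

lemma bump_scaled_tendsto: "(\<lambda>n. bump (real n * t)) \<longlonglongrightarrow> (if t > 0 then 1 else 0)"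
proof (cases "t > 0")
  case True
  then have "filterlim (\<lambda>n. real n * t) at_top sequentially"
    using filterlim_tendsto_pos_mult_at_top[OF tendsto_const True filterlim_real_sequentially]
    by (simp add: mult.commute)
  from filterlim_compose[OF exp_recip_tendsto[of 1] this] show ?thesis using True by simp
next
  case False
  then show ?thesis by (simp add: bump_eq_0 mult_nonneg_nonpos not_less)
qed

lemma box_bump_tendsto: "(\<lambda>n. box_bump a b n x) \<longlonglongrightarrow> indicator (box a b) x"
proof -
  let ?L = "\<Prod>i\<in>Basis. (if (x - a) \<bullet> i > 0 then 1 else 0) * (if (b - x) \<bullet> i > 0 then 1 else (0::real))"
  have "(\<lambda>n. box_bump a b n x) \<longlonglongrightarrow> ?L"
    unfolding box_bump_def by (intro tendsto_prod tendsto_mult bump_scaled_tendsto)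
  moreover have "?L = indicator (box a b) x"
  proof (cases "x \<in> box a b")
    case True
    then show ?thesis by (auto simp: mem_box inner_diff_left intro!: prod.neutral)
  next
    case False
    then show ?thesis by (auto simp: mem_box inner_diff_left prod_zero_iff)
  qed
  ultimately show ?thesis by simp
qed

text \<open>The fundamental lemma of the calculus of variations. Dominated convergence along
  \<open>box_bump\<close> turns orthogonality into vanishing integrals over boxes whose closed box
  lies in \<open>\<Omega>\<close>. Localisation then gives the claim on one closed box, and
  countably many of these cover \<open>\<Omega>\<close>.\<close>

lemma AE_eq_0_if_orthogonal_to_test_functions:
  fixes g :: "'a::euclidean_space \<Rightarrow> real"
  assumes \<Omega>: "open \<Omega>" and g: "integrable (lebesgue_on \<Omega>) g"
    and orth: "\<And>\<phi>. \<phi> \<in> test_functions \<Omega> \<Longrightarrow> (LINT x|lebesgue_on \<Omega>. g x * \<phi> x) = 0"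
  shows "AE x in lebesgue_on \<Omega>. g x = 0"
proof -
  let ?G = "\<lambda>x. if x \<in> \<Omega> then g x else 0"
  have \<Omega>L: "\<Omega> \<in> sets lebesgue" using \<Omega> by (rule open_sets_lebesgue)
  have G: "integrable lebesgue ?G"
    using g Lebesgue_Measure.integrable_restrict_UNIV[OF \<Omega>L, of g] by simp
  have box0: "(LINT x:box a b|lebesgue. ?G x) = 0" if "cbox a b \<subseteq> \<Omega>" for a b
  proof -
    let ?\<phi> = "box_bump a b"
    have m: "?\<phi> n \<in> borel_measurable lebesgue" for n
      using test_functions_measurable[OF box_bump_in_test_functions[OF that]]
      by (intro measurable_completion) simp
    have "(\<lambda>n. LINT x|lebesgue. ?\<phi> n x *\<^sub>R ?G x) \<longlonglongrightarrow> (LINT x|lebesgue. indicator (box a b) x *\<^sub>R ?G x)"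
    proof (rule integral_dominated_convergence[where w = "\<lambda>x. \<bar>?G x\<bar>"])
      show "AE x in lebesgue. norm (?\<phi> n x *\<^sub>R ?G x) \<le> \<bar>?G x\<bar>" for n
        using box_bump_nonneg[of a b n] box_bump_le_1[of a b n]
        by (intro AE_I2) (auto simp: abs_mult intro!: mult_left_le_one_le)
      show "AE x in lebesgue. (\<lambda>n. ?\<phi> n x *\<^sub>R ?G x) \<longlonglongrightarrow> indicator (box a b) x *\<^sub>R ?G x"
        by (intro AE_I2 tendsto_scaleR box_bump_tendsto tendsto_const)
      show "(\<lambda>x. ?\<phi> n x *\<^sub>R ?G x) \<in> borel_measurable lebesgue" for n
        by (intro borel_measurable_scaleR m borel_measurable_integrable[OF G])
      show "(\<lambda>x. indicator (box a b) x *\<^sub>R ?G x) \<in> borel_measurable lebesgue"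
        by (intro borel_measurable_scaleR borel_measurable_indicator borel_measurable_integrable[OF G]) auto
      show "integrable lebesgue (\<lambda>x. \<bar>?G x\<bar>)"
        using G by (rule integrable_abs)
    qed
    moreover have "(LINT x|lebesgue. ?\<phi> n x *\<^sub>R ?G x) = 0" for n
    proof -
      have "(LINT x|lebesgue. ?\<phi> n x *\<^sub>R ?G x) =
          (LINT x|lebesgue. (if x \<in> \<Omega> then g x * ?\<phi> n x else 0))"
        by (rule Bochner_Integration.integral_cong) auto
      also have "\<dots> = (LINT x|lebesgue_on \<Omega>. g x * ?\<phi> n x)"
        using \<Omega>L by (rule Lebesgue_Measure.integral_restrict_UNIV)
      finally show ?thesis
        using orth[OF box_bump_in_test_functions[OF that]] by simp
    qed
    ultimately show ?thesis
      by (simp add: LIMSEQ_const_iff set_lebesgue_integral_def)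
  qed
  have cbox0: "AE x in lebesgue. x \<in> cbox c d \<longrightarrow> ?G x = 0" if "cbox c d \<subseteq> \<Omega>" for c d
  proof -
    \<comment> \<open>Multiplying by the indicator of one box inside \<open>\<Omega>\<close> makes
      every box admissible, since any box meets \<open>box c d\<close> in a box that does not leave
      it.\<close>
    have int: "integrable lebesgue (\<lambda>x. indicator (box c d) x *\<^sub>R ?G x)"
      by (rule integrable_mult_indicator[OF _ G]) auto
    have "(LINT x:box a b|lebesgue. indicator (box c d) x *\<^sub>R ?G x) = 0" for a b
    proof -
      obtain e f where ef: "box a b \<inter> box c d = box e f"
        using that[OF box_Int_box] by this
      have "(LINT x:box a b|lebesgue. indicator (box c d) x *\<^sub>R ?G x) = (LINT x:box e f|lebesgue. ?G x)"
        unfolding set_lebesgue_integral_def ef[symmetric]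
        by (rule Bochner_Integration.integral_cong) (auto simp: indicator_def)
      also have "\<dots> = 0"
      \<comment> \<open>For an empty open box the closed box with the same corners may be nonempty
        and leave \<open>\<Omega>\<close>, so \<open>box0\<close> applies only to nonempty
        ones.\<close>
      proof (cases "box e f = {}")
        case True
        then show ?thesis by (simp add: set_lebesgue_integral_def)
      next
        case False
        then have "cbox e f = closure (box e f)" by (simp add: closure_box)
        also have "\<dots> \<subseteq> cbox c d"
          using ef box_subset_cbox[of c d] by (intro closure_minimal) auto
        finally show ?thesis using that by (intro box0) auto
      qed
      finally show ?thesis .
    qed
    from AE_lebesgue_eq_0_if_boxes[OF int this]
    have "AE x in lebesgue. indicator (box c d) x *\<^sub>R ?G x = 0" .
    moreover have "AE x in lebesgue. x \<notin> cbox c d - box c d"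
      using negligible_frontier_interval[of c d] unfolding negligible_iff_null_sets
      by (rule AE_not_in)
    ultimately show ?thesis
      by eventually_elim auto
  qed
  obtain \<D> where \<D>: "countable \<D>" "\<D> \<subseteq> Pow \<Omega>" "\<And>X. X \<in> \<D> \<Longrightarrow> \<exists>a b. X = cbox a b" "\<Union>\<D> = \<Omega>"
    using open_countable_Union_open_cbox[OF \<Omega>] by blast
  have "AE x in lebesgue. \<forall>X\<in>\<D>. x \<in> X \<longrightarrow> ?G x = 0"
    unfolding AE_ball_countable[OF \<D>(1)]
  proof
    fix X assume "X \<in> \<D>"
    then obtain a b where "X = cbox a b" "cbox a b \<subseteq> \<Omega>" using \<D> by blast
    then show "AE x in lebesgue. x \<in> X \<longrightarrow> ?G x = 0" using cbox0 by simp
  qed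
  then have "AE x in lebesgue. x \<in> \<Omega> \<longrightarrow> g x = 0"
  proof eventually_elim
    case (elim x)
    show ?case
    proof
      assume "x \<in> \<Omega>"
      then obtain X where "X \<in> \<D>" "x \<in> X" using \<D>(4) by blast
      then show "g x = 0" using elim \<open>x \<in> \<Omega>\<close> by auto
    qed
  qed
  then show ?thesis
    using \<Omega>L by (simp add: AE_restrict_space_iff)
qed

section \<open>Square-integrable functions on a bounded open set\<close>

lemma L2_measurable: "u \<in> L2 \<Omega> \<Longrightarrow> u \<in> borel_measurable (lebesgue_on \<Omega>)"
  and L2_square_integrable: "u \<in> L2 \<Omega> \<Longrightarrow> integrable (lebesgue_on \<Omega>) (\<lambda>x. (u x)\<^sup>2)"
  by (auto simp: L2_def)

lemma L2_diff:
  assumes "u \<in> L2 \<Omega>" "v \<in> L2 \<Omega>"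
  shows "(\<lambda>x. u x - v x) \<in> L2 \<Omega>"
proof -
  note [measurable] = L2_measurable[OF assms(1)] L2_measurable[OF assms(2)]
  have "integrable (lebesgue_on \<Omega>) (\<lambda>x. (u x - v x)\<^sup>2)"
  proof (rule Bochner_Integration.integrable_bound)
    show "integrable (lebesgue_on \<Omega>) (\<lambda>x. 2 * (u x)\<^sup>2 + 2 * (v x)\<^sup>2)"
      by (intro Bochner_Integration.integrable_add integrable_mult_right L2_square_integrable assms)
    have "(s - t)\<^sup>2 \<le> 2 * s\<^sup>2 + 2 * t\<^sup>2" for s t :: real
      using zero_le_power2[of "s + t"] by (simp add: power2_eq_square algebra_simps)
    then show "AE x in lebesgue_on \<Omega>. norm ((u x - v x)\<^sup>2) \<le> norm (2 * (u x)\<^sup>2 + 2 * (v x)\<^sup>2)"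
      by (intro AE_I2) simp
  qed measurable
  then show ?thesis by (simp add: L2_def)
qed

lemma integrable_const_lebesgue_on:
  fixes c :: real
  assumes "open \<Omega>" "bounded \<Omega>"
  shows "integrable (lebesgue_on \<Omega>) (\<lambda>x. c)"
  using finite_measure_lebesgue_on[OF lmeasurable_open[OF assms(2,1)]]
  by (simp add: finite_measure.integrable_const)

text \<open>On a set of finite measure the constant 1 is integrable, and |t| \<le> 1 + t^2.\<close>

lemma L2_integrable:
  fixes \<Omega> :: "'a::euclidean_space set"
  assumes "open \<Omega>" "bounded \<Omega>" "u \<in> L2 \<Omega>"
  shows "integrable (lebesgue_on \<Omega>) u"
proof (rule Bochner_Integration.integrable_bound)
  show "integrable (lebesgue_on \<Omega>) (\<lambda>x. 1 + (u x)\<^sup>2)"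
    using assms by (intro Bochner_Integration.integrable_add integrable_const_lebesgue_on L2_square_integrable)
  have "\<bar>t\<bar> \<le> 1 + t\<^sup>2" for t :: real
    using zero_le_power2[of "\<bar>t\<bar> - 1"] zero_le_power2[of t] by (simp add: power2_diff)
  then show "AE x in lebesgue_on \<Omega>. norm (u x) \<le> norm (1 + (u x)\<^sup>2)"
    by (intro AE_I2) (simp add: add_nonneg_nonneg)
qed (rule L2_measurable[OF assms(3)])

lemma bounded_measurable_in_L2:
  fixes \<Omega> :: "'a::euclidean_space set"
  assumes "open \<Omega>" "bounded \<Omega>" "u \<in> borel_measurable (lebesgue_on \<Omega>)" "\<And>x. x \<in> \<Omega> \<Longrightarrow> \<bar>u x\<bar> \<le> M"
  shows "u \<in> L2 \<Omega>"
proof -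
  have "integrable (lebesgue_on \<Omega>) (\<lambda>x. (u x)\<^sup>2)"
  proof (rule Bochner_Integration.integrable_bound)
    show "integrable (lebesgue_on \<Omega>) (\<lambda>x. M\<^sup>2)"
      using assms(1,2) by (rule integrable_const_lebesgue_on)
    show "(\<lambda>x. (u x)\<^sup>2) \<in> borel_measurable (lebesgue_on \<Omega>)"
      using assms(3) by measurable
    show "AE x in lebesgue_on \<Omega>. norm ((u x)\<^sup>2) \<le> norm (M\<^sup>2)"
    proof (rule AE_I2)
      fix x assume "x \<in> space (lebesgue_on \<Omega>)"
      then have "\<bar>u x\<bar> \<le> M" using assms(4) by simp
      then have "\<bar>u x\<bar>\<^sup>2 \<le> M\<^sup>2" by (intro power_mono) auto
      then show "norm ((u x)\<^sup>2) \<le> norm (M\<^sup>2)" by simp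
    qed
  qed
  then show ?thesis using assms(3) by (simp add: L2_def)
qed

lemma measurable_lebesgue_on_of_borel:
  "f \<in> borel_measurable borel \<Longrightarrow> f \<in> borel_measurable (lebesgue_on S)"
  by (intro measurable_restrict_space1 measurable_completion) simp

lemma test_functions_in_L2:
  fixes \<Omega> :: "'a::euclidean_space set"
  assumes "open \<Omega>" "bounded \<Omega>" "\<phi> \<in> test_functions \<Omega>"
  shows "\<phi> \<in> L2 \<Omega>"
proof -
  obtain M where "\<And>x. \<bar>\<phi> x\<bar> \<le> M"
    using test_functions_bounded[OF assms(3)] by blast
  then show ?thesis
    using assms test_functions_measurable[OF assms(3)]
    by (intro bounded_measurable_in_L2 measurable_lebesgue_on_of_borel)
qed

lemma L2_times_test_function_integrable:
  fixes \<Omega> :: "'a::euclidean_space set"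
  assumes "open \<Omega>" "bounded \<Omega>" "u \<in> L2 \<Omega>" "\<phi> \<in> test_functions \<Omega>"
  shows "integrable (lebesgue_on \<Omega>) (\<lambda>x. u x * \<phi> x)"
proof -
  obtain M where M: "M \<ge> 0" "\<And>x. \<bar>\<phi> x\<bar> \<le> M"
    using test_functions_bounded[OF assms(4)] by blast
  note [measurable] = L2_measurable[OF assms(3)]
    measurable_lebesgue_on_of_borel[OF test_functions_measurable[OF assms(4)], of \<Omega>]
  show ?thesis
  proof (rule Bochner_Integration.integrable_bound)
    show "integrable (lebesgue_on \<Omega>) (\<lambda>x. M * u x)"
      using L2_integrable[OF assms(1-3)] by simp
    show "AE x in lebesgue_on \<Omega>. norm (u x * \<phi> x) \<le> norm (M * u x)"
      using M by (intro AE_I2) (simp add: abs_mult mult.commute mult_right_mono)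
  qed measurable
qed

text \<open>Both candidates have the same integrals against every test function, so their difference
  falls under the fundamental lemma; boundedness of \<open>\<Omega>\<close> makes this difference
  integrable.\<close>

lemma weak_deriv_unique:
  fixes \<Omega> :: "'a::euclidean_space set"
  assumes "open \<Omega>" "bounded \<Omega>" "g \<in> L2 \<Omega>" "h \<in> L2 \<Omega>"
    "has_weak_deriv \<Omega> \<alpha> u g" "has_weak_deriv \<Omega> \<alpha> u h"
  shows "AE x in lebesgue_on \<Omega>. g x = h x"
proof -
  have "AE x in lebesgue_on \<Omega>. g x - h x = 0"
  proof (rule AE_eq_0_if_orthogonal_to_test_functions[OF assms(1)])
    show "integrable (lebesgue_on \<Omega>) (\<lambda>x. g x - h x)"
      using assms by (intro L2_integrable L2_diff)
    fix \<phi> assume \<phi>: "\<phi> \<in> test_functions \<Omega>"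
    have "(- 1) ^ size \<alpha> * (LINT x|lebesgue_on \<Omega>. g x * \<phi> x) =
        (- 1) ^ size \<alpha> * (LINT x|lebesgue_on \<Omega>. h x * \<phi> x)"
      using assms(5,6) \<phi> by (simp add: has_weak_deriv_def)
    then have "(LINT x|lebesgue_on \<Omega>. g x * \<phi> x) = (LINT x|lebesgue_on \<Omega>. h x * \<phi> x)"
      by simp
    then show "(LINT x|lebesgue_on \<Omega>. (g x - h x) * \<phi> x) = 0"
      using L2_times_test_function_integrable[OF assms(1,2,3) \<phi>]
        L2_times_test_function_integrable[OF assms(1,2,4) \<phi>]
      by (simp add: left_diff_distrib)
  qed
  then show ?thesis by simp
qed

text \<open>The gate from explicit derivatives to the chosen one: exhibiting any square-integrable
  weak derivative determines \<open>weak_deriv\<close> almost everywhere.\<close>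

lemma weak_deriv_eqI:
  fixes \<Omega> :: "'a::euclidean_space set"
  assumes "open \<Omega>" "bounded \<Omega>" "g \<in> L2 \<Omega>" "has_weak_deriv \<Omega> \<alpha> u g"
  shows "weak_deriv \<Omega> \<alpha> u \<in> L2 \<Omega>" "has_weak_deriv \<Omega> \<alpha> u (weak_deriv \<Omega> \<alpha> u)"
    "AE x in lebesgue_on \<Omega>. weak_deriv \<Omega> \<alpha> u x = g x"
proof -
  have "\<exists>g. g \<in> L2 \<Omega> \<and> has_weak_deriv \<Omega> \<alpha> u g"
    using assms by blast
  from someI_ex[OF this] show 1: "weak_deriv \<Omega> \<alpha> u \<in> L2 \<Omega>"
    and 2: "has_weak_deriv \<Omega> \<alpha> u (weak_deriv \<Omega> \<alpha> u)"
    unfolding weak_deriv_def by auto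
  show "AE x in lebesgue_on \<Omega>. weak_deriv \<Omega> \<alpha> u x = g x"
    by (rule weak_deriv_unique[OF assms(1,2) 1 assms(3) 2 assms(4)])
qed

section \<open>Sobolev spaces\<close>

lemma has_weak_deriv_diff:
  fixes \<Omega> :: "'a::euclidean_space set"
  assumes "open \<Omega>" "bounded \<Omega>" "u \<in> L2 \<Omega>" "v \<in> L2 \<Omega>" "g \<in> L2 \<Omega>" "h \<in> L2 \<Omega>"
    "has_weak_deriv \<Omega> \<alpha> u g" "has_weak_deriv \<Omega> \<alpha> v h"
  shows "has_weak_deriv \<Omega> \<alpha> (\<lambda>x. u x - v x) (\<lambda>x. g x - h x)"
  unfolding has_weak_deriv_def
proof
  fix \<phi> assume \<phi>: "\<phi> \<in> test_functions \<Omega>"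
  have d\<phi>: "multi_partial \<alpha> \<phi> \<in> test_functions \<Omega>"
    unfolding multi_partial_def by (rule test_functions_iter_partial[OF \<phi>])
  note int = L2_times_test_function_integrable[OF assms(1,2)]
  show "(LINT x|lebesgue_on \<Omega>. (u x - v x) * multi_partial \<alpha> \<phi> x) =
      (- 1) ^ size \<alpha> * (LINT x|lebesgue_on \<Omega>. (g x - h x) * \<phi> x)"
    using assms(7,8) \<phi> int[OF assms(3) d\<phi>] int[OF assms(4) d\<phi>] int[OF assms(5) \<phi>] int[OF assms(6) \<phi>]
    by (simp add: has_weak_deriv_def left_diff_distrib right_diff_distrib)
qed

lemma sobolev_L2: "u \<in> sobolev n \<Omega> \<Longrightarrow> u \<in> L2 \<Omega>"
  by (simp add: sobolev_def)

lemma sobolev_weak_deriv: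
  fixes \<Omega> :: "'a::euclidean_space set"
  assumes "open \<Omega>" "bounded \<Omega>" "u \<in> sobolev n \<Omega>" "\<alpha> \<in> multi_indices" "size \<alpha> \<le> n"
  shows "weak_deriv \<Omega> \<alpha> u \<in> L2 \<Omega>" "has_weak_deriv \<Omega> \<alpha> u (weak_deriv \<Omega> \<alpha> u)"
proof -
  obtain g where "g \<in> L2 \<Omega>" "has_weak_deriv \<Omega> \<alpha> u g"
    using assms by (auto simp: sobolev_def)
  from weak_deriv_eqI(1,2)[OF assms(1,2) this]
  show "weak_deriv \<Omega> \<alpha> u \<in> L2 \<Omega>" "has_weak_deriv \<Omega> \<alpha> u (weak_deriv \<Omega> \<alpha> u)" .
qed

lemma weak_deriv_diff_AE:
  fixes \<Omega> :: "'a::euclidean_space set"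
  assumes "open \<Omega>" "bounded \<Omega>" "u \<in> sobolev n \<Omega>" "v \<in> sobolev n \<Omega>" "\<alpha> \<in> multi_indices" "size \<alpha> \<le> n"
  shows "AE x in lebesgue_on \<Omega>. weak_deriv \<Omega> \<alpha> (\<lambda>x. u x - v x) x = weak_deriv \<Omega> \<alpha> u x - weak_deriv \<Omega> \<alpha> v x"
proof -
  note u = sobolev_weak_deriv[OF assms(1,2,3,5,6)]
  note v = sobolev_weak_deriv[OF assms(1,2,4,5,6)]
  show ?thesis
    by (rule weak_deriv_eqI(3)[OF assms(1,2) L2_diff[OF u(1) v(1)]])
      (rule has_weak_deriv_diff[OF assms(1,2) sobolev_L2[OF assms(3)] sobolev_L2[OF assms(4)] u(1) v(1) u(2) v(2)])
qed

lemma sobolev_diff: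
  fixes \<Omega> :: "'a::euclidean_space set"
  assumes "open \<Omega>" "bounded \<Omega>" "u \<in> sobolev n \<Omega>" "v \<in> sobolev n \<Omega>"
  shows "(\<lambda>x. u x - v x) \<in> sobolev n \<Omega>"
  unfolding sobolev_def
proof (intro CollectI conjI ballI impI)
  show "(\<lambda>x. u x - v x) \<in> L2 \<Omega>"
    using assms by (intro L2_diff sobolev_L2)
  fix \<alpha> :: "'a multiset" assume \<alpha>: "\<alpha> \<in> multi_indices" "size \<alpha> \<le> n"
  note u = sobolev_weak_deriv[OF assms(1,2,3) \<alpha>]
  note v = sobolev_weak_deriv[OF assms(1,2,4) \<alpha>]
  show "\<exists>g\<in>L2 \<Omega>. has_weak_deriv \<Omega> \<alpha> (\<lambda>x. u x - v x) g"
    using has_weak_deriv_diff[OF assms(1,2) sobolev_L2[OF assms(3)] sobolev_L2[OF assms(4)] u(1) v(1) u(2) v(2)]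
      L2_diff[OF u(1) v(1)] by blast
qed

text \<open>Lets a Sobolev norm be computed with explicit derivatives \<open>g\<close> in place of
  the chosen representatives, which have the same square integrals.\<close>

lemma sobolev_norm_tendsto_0I:
  fixes \<Omega> :: "'a::euclidean_space set"
  assumes "open \<Omega>" "bounded \<Omega>"
    and "\<And>n \<alpha>. \<alpha> \<in> multi_indices \<Longrightarrow> size \<alpha> \<le> m \<Longrightarrow> g n \<alpha> \<in> L2 \<Omega> \<and> has_weak_deriv \<Omega> \<alpha> (v n) (g n \<alpha>)"
    and "\<And>\<alpha>. \<alpha> \<in> multi_indices \<Longrightarrow> size \<alpha> \<le> m \<Longrightarrow>
      (\<lambda>n. LINT x|lebesgue_on \<Omega>. (g n \<alpha> x)\<^sup>2) \<longlonglongrightarrow> 0"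
  shows "(\<lambda>n. sobolev_norm m \<Omega> (v n)) \<longlonglongrightarrow> 0"
proof -
  have eq: "(LINT x|lebesgue_on \<Omega>. (weak_deriv \<Omega> \<alpha> (v n) x)\<^sup>2) = (LINT x|lebesgue_on \<Omega>. (g n \<alpha> x)\<^sup>2)"
    if \<alpha>: "\<alpha> \<in> multi_indices" "size \<alpha> \<le> m" for \<alpha> n
  proof -
    note d = weak_deriv_eqI[OF assms(1,2) conjunct1[OF assms(3)[OF \<alpha>]] conjunct2[OF assms(3)[OF \<alpha>]], of n]
    show ?thesis
      by (rule integral_cong_AE)
        (use d(1,3) assms(3)[OF \<alpha>, of n] in \<open>auto simp: L2_def elim!: eventually_mono\<close>)
  qed
  have "(\<lambda>n. LINT x|lebesgue_on \<Omega>. (weak_deriv \<Omega> \<alpha> (v n) x)\<^sup>2) \<longlonglongrightarrow> 0"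
    if "\<alpha> \<in> {\<alpha> \<in> multi_indices. size \<alpha> \<le> m}" for \<alpha>
    using assms(4)[of \<alpha>] eq that by simp
  then have "(\<lambda>n. \<Sum>\<alpha>\<in>{\<alpha> \<in> multi_indices. size \<alpha> \<le> m}. LINT x|lebesgue_on \<Omega>. (weak_deriv \<Omega> \<alpha> (v n) x)\<^sup>2) \<longlonglongrightarrow> 0"
    by (rule tendsto_null_sum)
  from tendsto_real_sqrt[OF this] show ?thesis
    by (simp add: sobolev_norm_def)
qed

text \<open>The continuous extension of the derivative is bounded on the compact closure, and
  bounded measurable functions on a set of finite measure are square integrable.\<close>

lemma iter_partial_in_L2:
  fixes \<Omega> :: "'a::euclidean_space set"
  assumes "open \<Omega>" "bounded \<Omega>" "smooth_on_closure \<Omega> u" "set bs \<subseteq> Basis"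
  shows "iter_partial bs u \<in> L2 \<Omega>"
proof -
  obtain g where g: "continuous_on (closure \<Omega>) g" "\<And>x. x \<in> \<Omega> \<Longrightarrow> g x = iter_partial bs u x"
    using assms by (auto simp: smooth_on_closure_def)
  have "bounded (g ` closure \<Omega>)"
    using assms(2) g(1) by (intro compact_imp_bounded compact_continuous_image) auto
  then obtain M where "\<And>x. x \<in> closure \<Omega> \<Longrightarrow> \<bar>g x\<bar> \<le> M"
    by (auto simp: bounded_iff)
  then have M: "\<bar>iter_partial bs u x\<bar> \<le> M" if "x \<in> \<Omega>" for x
    using g(2)[OF that] closure_subset[of \<Omega>] that by (metis subsetD)
  have "smooth_on \<Omega> (iter_partial bs u)"
    using assms(3) by (auto simp: smooth_on_closure_def intro: smooth_on_iter_partial)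
  then have "iter_partial bs u \<in> borel_measurable (lebesgue_on \<Omega>)"
    using assms(1) by (intro continuous_imp_measurable_on_sets_lebesgue smooth_on_imp_continuous_on) auto
  from bounded_measurable_in_L2[OF assms(1,2) this M] show ?thesis .
qed

lemma smooth_on_closure_in_sobolev:
  fixes \<Omega> :: "'a::euclidean_space set"
  assumes "open \<Omega>" "bounded \<Omega>" "smooth_on_closure \<Omega> u"
  shows "u \<in> sobolev m \<Omega>"
  unfolding sobolev_def
proof (intro CollectI conjI ballI impI)
  show "u \<in> L2 \<Omega>"
    using iter_partial_in_L2[OF assms, of "[]"] by (simp add: iter_partial_def)
  fix \<alpha> :: "'a multiset" assume "\<alpha> \<in> multi_indices"
  have "smooth_on \<Omega> u" using assms(3) by (simp add: smooth_on_closure_def)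
  from smooth_on_has_weak_deriv[OF assms(1) this, of \<alpha>] obtain bs
    where bs: "mset bs = \<alpha>" "has_weak_deriv \<Omega> \<alpha> u (iter_partial bs u)"
    by blast
  then have "set bs \<subseteq> Basis"
    using \<open>\<alpha> \<in> multi_indices\<close> by (auto simp: multi_indices_def)
  then show "\<exists>g\<in>L2 \<Omega>. has_weak_deriv \<Omega> \<alpha> u g"
    using bs(2) iter_partial_in_L2[OF assms] by blast
qed

section \<open>Sobolev norms and differences in \<open>H10\<close>\<close>

lemma sobolev_norm_nonneg: "sobolev_norm m \<Omega> u \<ge> 0"
  and sobolev_seminorm_nonneg: "sobolev_seminorm m \<Omega> u \<ge> 0"
  by (simp_all add: sobolev_norm_def sobolev_seminorm_def sum_nonneg)

lemma sobolev_norm_power2: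
  "(sobolev_norm m \<Omega> u)\<^sup>2 =
    (\<Sum>\<alpha>\<in>{\<alpha>\<in>multi_indices. size \<alpha> \<le> m}. LINT x|lebesgue_on \<Omega>. (weak_deriv \<Omega> \<alpha> u x)\<^sup>2)"
  by (simp add: sobolev_norm_def sum_nonneg)

text \<open>A crude triangle inequality: (s - t)^2 \<le> 2 s^2 + 2 t^2 is integrated for each
  multi-index. The factor 2 is harmless, as the estimate serves only for sequences of norms that
  tend to 0.\<close>

lemma sobolev_norm_diff_power2_le:
  fixes \<Omega> :: "'a::euclidean_space set"
  assumes "open \<Omega>" "bounded \<Omega>" "u \<in> sobolev m \<Omega>" "v \<in> sobolev m \<Omega>"
  shows "(sobolev_norm m \<Omega> (\<lambda>x. u x - v x))\<^sup>2 \<le> 2 * (sobolev_norm m \<Omega> u)\<^sup>2 + 2 * (sobolev_norm m \<Omega> v)\<^sup>2"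
proof -
  have "(LINT x|lebesgue_on \<Omega>. (weak_deriv \<Omega> \<alpha> (\<lambda>x. u x - v x) x)\<^sup>2)
      \<le> 2 * (LINT x|lebesgue_on \<Omega>. (weak_deriv \<Omega> \<alpha> u x)\<^sup>2) + 2 * (LINT x|lebesgue_on \<Omega>. (weak_deriv \<Omega> \<alpha> v x)\<^sup>2)"
    if "\<alpha> \<in> {\<alpha>\<in>multi_indices. size \<alpha> \<le> m}" for \<alpha>
  proof -
    have \<alpha>: "\<alpha> \<in> multi_indices" "size \<alpha> \<le> m" using that by auto
    note u = L2_square_integrable[OF sobolev_weak_deriv(1)[OF assms(1,2,3) \<alpha>]]
    note v = L2_square_integrable[OF sobolev_weak_deriv(1)[OF assms(1,2,4) \<alpha>]]
    note d = L2_square_integrable[OF sobolev_weak_deriv(1)[OF assms(1,2) sobolev_diff[OF assms] \<alpha>]]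
    have ineq: "(s - t)\<^sup>2 \<le> 2 * s\<^sup>2 + 2 * t\<^sup>2" for s t :: real
      using zero_le_power2[of "s + t"] by (simp add: power2_eq_square algebra_simps)
    have "(LINT x|lebesgue_on \<Omega>. (weak_deriv \<Omega> \<alpha> (\<lambda>x. u x - v x) x)\<^sup>2)
        \<le> (LINT x|lebesgue_on \<Omega>. 2 * (weak_deriv \<Omega> \<alpha> u x)\<^sup>2 + 2 * (weak_deriv \<Omega> \<alpha> v x)\<^sup>2)"
    proof (rule integral_mono_AE[OF d])
      show "integrable (lebesgue_on \<Omega>) (\<lambda>x. 2 * (weak_deriv \<Omega> \<alpha> u x)\<^sup>2 + 2 * (weak_deriv \<Omega> \<alpha> v x)\<^sup>2)"
        using u v by simp
      show "AE x in lebesgue_on \<Omega>. (weak_deriv \<Omega> \<alpha> (\<lambda>x. u x - v x) x)\<^sup>2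
          \<le> 2 * (weak_deriv \<Omega> \<alpha> u x)\<^sup>2 + 2 * (weak_deriv \<Omega> \<alpha> v x)\<^sup>2"
        using weak_deriv_diff_AE[OF assms \<alpha>] by eventually_elim (simp add: ineq)
    qed
    then show ?thesis using u v by simp
  qed
  then show ?thesis
    unfolding sobolev_norm_power2 sum_distrib_left sum.distrib[symmetric] by (rule sum_mono)
qed

lemma test_functions_in_sobolev_1:
  fixes \<Omega> :: "'a::euclidean_space set"
  assumes "open \<Omega>" "bounded \<Omega>" "\<phi> \<in> test_functions \<Omega>"
  shows "\<phi> \<in> sobolev 1 \<Omega>"
  unfolding sobolev_def
proof (intro CollectI conjI ballI impI)
  show "\<phi> \<in> L2 \<Omega>" using assms by (rule test_functions_in_L2)
  fix \<alpha> :: "'a multiset"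
  obtain bs where "has_weak_deriv \<Omega> \<alpha> \<phi> (iter_partial bs \<phi>)"
    using smooth_on_has_weak_deriv[OF assms(1) test_functions_smooth[OF assms(3)]] by blast
  then show "\<exists>g\<in>L2 \<Omega>. has_weak_deriv \<Omega> \<alpha> \<phi> g"
    using test_functions_in_L2[OF assms(1,2) test_functions_iter_partial[OF assms(3)]] by blast
qed

lemma H10_sobolev: "u \<in> H10 \<Omega> \<Longrightarrow> u \<in> sobolev 1 \<Omega>"
  by (simp add: H10_def)

lemma H10_diff:
  fixes \<Omega> :: "'a::euclidean_space set"
  assumes "open \<Omega>" "bounded \<Omega>" "u \<in> H10 \<Omega>" "v \<in> H10 \<Omega>"
  shows "(\<lambda>x. u x - v x) \<in> H10 \<Omega>"
proof -
  obtain \<phi> where \<phi>: "\<And>n. \<phi> n \<in> test_functions \<Omega>" "(\<lambda>n. sobolev_norm 1 \<Omega> (\<lambda>x. u x - \<phi> n x)) \<longlonglongrightarrow> 0"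
    using assms(3) by (auto simp: H10_def)
  obtain \<psi> where \<psi>: "\<And>n. \<psi> n \<in> test_functions \<Omega>" "(\<lambda>n. sobolev_norm 1 \<Omega> (\<lambda>x. v x - \<psi> n x)) \<longlonglongrightarrow> 0"
    using assms(4) by (auto simp: H10_def)
  let ?\<chi> = "\<lambda>n x. \<phi> n x - \<psi> n x"
  let ?bound = "\<lambda>n. 2 * (sobolev_norm 1 \<Omega> (\<lambda>x. u x - \<phi> n x))\<^sup>2 + 2 * (sobolev_norm 1 \<Omega> (\<lambda>x. v x - \<psi> n x))\<^sup>2"
  have le: "(sobolev_norm 1 \<Omega> (\<lambda>x. (u x - v x) - ?\<chi> n x))\<^sup>2 \<le> ?bound n" for n
  proof -
    have "(\<lambda>x. u x - \<phi> n x) \<in> sobolev 1 \<Omega>" "(\<lambda>x. v x - \<psi> n x) \<in> sobolev 1 \<Omega>"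
      by (intro sobolev_diff H10_sobolev test_functions_in_sobolev_1 assms \<phi>(1) \<psi>(1))+
    note sobolev_norm_diff_power2_le[OF assms(1,2) this]
    moreover have "(\<lambda>x. (u x - v x) - ?\<chi> n x) = (\<lambda>x. (u x - \<phi> n x) - (v x - \<psi> n x))" by auto
    ultimately show ?thesis by simp
  qed
  have "?bound \<longlonglongrightarrow> 2 * 0\<^sup>2 + 2 * 0\<^sup>2"
    by (intro tendsto_intros \<phi>(2) \<psi>(2))
  then have "(\<lambda>n. (sobolev_norm 1 \<Omega> (\<lambda>x. (u x - v x) - ?\<chi> n x))\<^sup>2) \<longlonglongrightarrow> 0"
    using tendsto_sandwich[OF _ _ tendsto_const, of 0 "\<lambda>n. (sobolev_norm 1 \<Omega> (\<lambda>x. (u x - v x) - ?\<chi> n x))\<^sup>2" sequentially ?bound]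
      le by simp
  then have "(\<lambda>n. sobolev_norm 1 \<Omega> (\<lambda>x. (u x - v x) - ?\<chi> n x)) \<longlonglongrightarrow> 0"
    by (rule power_tendsto_0_iff[THEN iffD1, rotated]) simp
  moreover have "\<forall>n. ?\<chi> n \<in> test_functions \<Omega>"
    using \<phi>(1) \<psi>(1) by (intro allI test_functions_diff)
  moreover have "(\<lambda>x. u x - v x) \<in> sobolev 1 \<Omega>"
    using assms by (intro sobolev_diff H10_sobolev)
  ultimately show ?thesis
    unfolding H10_def by (intro CollectI conjI exI[of _ ?\<chi>])
qed

section \<open>Smooth functions vanishing on the boundary\<close>

text \<open>This is t \<eta>(n t) with \<eta>(s) = \<open>bump (s\<^sup>2 - 1)\<close>: the square
  treats both signs alike and keeps the function smooth. It vanishes where |n t| \<le> 1 and tends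
  to t as \<open>n\<close> grows.\<close>

definition cutoff :: "nat \<Rightarrow> real \<Rightarrow> real" where
  "cutoff n t = t * bump ((real n * t)\<^sup>2 - 1)"

text \<open>With s = (n t)^2 - 1 and y = 1/s, the product rule gives exp(-y) + 2 (s + 1) y^2
  exp(-y), and (s + 1) y^2 = y + y^2. This is the origin of the polynomial 1 + 2 y + 2 y^2.\<close>

definition cutoff_deriv :: "nat \<Rightarrow> real \<Rightarrow> real" where
  "cutoff_deriv n t = exp_recip [:1, 2, 2:] ((real n * t)\<^sup>2 - 1)"

lemma cutoff_has_derivative: "(cutoff n has_real_derivative cutoff_deriv n t) (at t)"
proof -
  let ?s = "(real n * t)\<^sup>2 - 1"
  have key: "bump s + 2 * (s + 1) * exp_recip [:0, 0, 1:] s = exp_recip [:1, 2, 2:] s" for s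
    by (simp add: exp_recip_def field_simps power2_eq_square)
  have "((\<lambda>t. (real n * t)\<^sup>2 - 1) has_real_derivative 2 * real n * (real n * t)) (at t)"
    by (auto intro!: derivative_eq_intros)
  note DERIV_mult[OF DERIV_ident DERIV_chain2[OF exp_recip_has_derivative[of 1] this]]
  moreover have "exp_recip_step 1 = [:0, 0, 1:]"
    by (simp add: exp_recip_step_def)
  moreover have "1 * bump ?s + exp_recip [:0, 0, 1:] ?s * (2 * real n * (real n * t)) * t = cutoff_deriv n t"
    unfolding cutoff_deriv_def key[symmetric] by (simp add: power2_eq_square algebra_simps)
  ultimately show ?thesis
    unfolding cutoff_def[abs_def] by simp
qed

text \<open>The derivative depends only on s = (n t)^2 - 1, so a bound in s is uniform in
  \<open>n\<close>. The 4 is the smallest factor for which 4 (1 + y + y^2/2), a multiple of the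
  quadratic Taylor bound for exp y, dominates the coefficient 2 of y^2.\<close>

lemma cutoff_deriv_bound: "\<bar>cutoff_deriv n t\<bar> \<le> 4"
proof -
  have "\<bar>exp_recip [:1, 2, 2:] s\<bar> \<le> 4" for s
  proof (cases "s > 0")
    case True
    define y where "y = 1 / s"
    have y: "y > 0" using True by (simp add: y_def)
    have "1 + 2 * y + 2 * y\<^sup>2 \<le> 4 * (1 + y + y\<^sup>2 / 2)" using y by simp
    also have "\<dots> \<le> 4 * exp y"
      using exp_lower_Taylor_quadratic[of y] y by simp
    finally have "(1 + 2 * y + 2 * y\<^sup>2) * exp (- y) \<le> 4"
      by (simp add: exp_minus field_simps)
    moreover have "(1 + 2 * y + 2 * y\<^sup>2) * exp (- y) \<ge> 0" using y by simp
    moreover have "exp_recip [:1, 2, 2:] s = (1 + 2 * y + 2 * y\<^sup>2) * exp (- y)"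
      using True by (simp add: exp_recip_def y_def power2_eq_square algebra_simps)
    ultimately show ?thesis by simp
  next
    case False
    then show ?thesis by (simp add: exp_recip_def)
  qed
  then show ?thesis by (simp add: cutoff_deriv_def)
qed

lemma exp_recip_cutoff_tendsto:
  assumes "t \<noteq> 0"
  shows "(\<lambda>n. exp_recip p ((real n * t)\<^sup>2 - 1)) \<longlonglongrightarrow> poly p 0"
proof -
  have "filterlim (\<lambda>n. t\<^sup>2 * (real n * real n)) at_top sequentially"
    using assms
    by (intro filterlim_tendsto_pos_mult_at_top[OF tendsto_const] filterlim_at_top_mult_at_top
        filterlim_real_sequentially) auto
  then have "filterlim (\<lambda>n. - 1 + t\<^sup>2 * (real n * real n)) at_top sequentially"
    by (rule filterlim_tendsto_add_at_top[OF tendsto_const])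
  moreover have "(\<lambda>n. - 1 + t\<^sup>2 * (real n * real n)) = (\<lambda>n. (real n * t)\<^sup>2 - 1)"
    by (auto simp: power2_eq_square algebra_simps)
  ultimately show ?thesis
    using filterlim_compose[OF exp_recip_tendsto] by metis
qed

lemma cutoff_tendsto: "(\<lambda>n. cutoff n t) \<longlonglongrightarrow> t"
proof (cases "t = 0")
  case False
  from tendsto_mult[OF tendsto_const exp_recip_cutoff_tendsto[OF this, of 1], of t]
  show ?thesis by (simp add: cutoff_def)
qed (simp add: cutoff_def)

text \<open>At 0 every cutoff has derivative 0, while the identity has derivative 1. This jump is
  why the gradient on the zero set needs a separate argument.\<close>

lemma cutoff_deriv_tendsto: "(\<lambda>n. cutoff_deriv n t) \<longlonglongrightarrow> (if t = 0 then 0 else 1)"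
proof (cases "t = 0")
  case False
  from exp_recip_cutoff_tendsto[OF this, of "[:1, 2, 2:]"]
  show ?thesis using False by (simp add: cutoff_deriv_def)
qed (simp add: cutoff_deriv_def exp_recip_def)

lemma cutoff_bound: "\<bar>cutoff n t\<bar> \<le> \<bar>t\<bar>" and cutoff_diff_bound: "\<bar>t - cutoff n t\<bar> \<le> \<bar>t\<bar>"
proof -
  let ?b = "bump ((real n * t)\<^sup>2 - 1)"
  have b: "0 \<le> ?b" "?b \<le> 1" by (rule bump_nonneg bump_le_1)+
  then show "\<bar>cutoff n t\<bar> \<le> \<bar>t\<bar>"
    by (simp add: cutoff_def abs_mult mult_left_le)
  have "t - cutoff n t = t * (1 - ?b)" by (simp add: cutoff_def algebra_simps)
  with b show "\<bar>t - cutoff n t\<bar> \<le> \<bar>t\<bar>"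
    by (simp add: abs_mult mult_left_le)
qed

lemma smooth_on_cutoff:
  assumes "open S" "smooth_on S u"
  shows "smooth_on S (\<lambda>x. cutoff n (u x))"
  unfolding cutoff_def power2_eq_square
  by (intro smooth_on_mult smooth_on_exp_recip smooth_on_diff smooth_on_const assms)

text \<open>The set where |n u| \<ge> 1 is closed in the compact closure and misses the frontier,
  where \<open>u\<close> is zero; hence it is a compact subset of \<open>\<Omega>\<close> that
  carries the truncation.\<close>

lemma cutoff_in_test_functions:
  fixes \<Omega> :: "'a::euclidean_space set"
  assumes "open \<Omega>" "bounded \<Omega>" "smooth_on \<Omega> u" "continuous_on (closure \<Omega>) u" "\<And>x. x \<in> frontier \<Omega> \<Longrightarrow> u x = 0"
  shows "(\<lambda>x. if x \<in> \<Omega> then cutoff n (u x) else 0) \<in> test_functions \<Omega>"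
proof (rule extend_by_zero_in_test_functions[OF assms(1) smooth_on_cutoff[OF assms(1,3)]])
  let ?K = "closure \<Omega> \<inter> {x. 1 \<le> (real n * u x)\<^sup>2}"
  have "continuous_on (closure \<Omega>) (\<lambda>x. (real n * u x)\<^sup>2)"
    using assms(4) by (intro continuous_intros)
  then have "closed (closure \<Omega> \<inter> (\<lambda>x. (real n * u x)\<^sup>2) -` {1..})"
    by (intro continuous_closed_preimage) auto
  moreover have "closure \<Omega> \<inter> (\<lambda>x. (real n * u x)\<^sup>2) -` {1..} = ?K" by auto
  ultimately have "closed ?K" by simp
  then show "compact ?K"
    using assms(2) compact_Int_closed[of "closure \<Omega>" ?K] by (simp add: compact_closure)
  show "?K \<subseteq> \<Omega>"
  proof
    fix x assume x: "x \<in> ?K"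
    then have "u x \<noteq> 0" by auto
    then have "x \<notin> frontier \<Omega>" using assms(5) by blast
    then show "x \<in> \<Omega>" using x assms(1) by (auto simp: frontier_def interior_open)
  qed
  show "cutoff n (u x) = 0" if "x \<in> \<Omega>" "x \<notin> ?K" for x
    using that closure_subset[of \<Omega>] by (auto simp: cutoff_def bump_eq_0 not_le)
qed

lemma partial_deriv_cutoff:
  fixes \<Omega> :: "'a::euclidean_space set"
  assumes "open \<Omega>" "smooth_on \<Omega> u" "x \<in> \<Omega>"
  shows "partial_deriv b (\<lambda>x. if x \<in> \<Omega> then cutoff n (u x) else 0) x = cutoff_deriv n (u x) * partial_deriv b u x"
proof -
  have "((\<lambda>x. cutoff n (u x)) has_derivative (\<lambda>v. cutoff_deriv n (u x) * partial_deriv v u x)) (at x)"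
    using has_derivative_compose[OF smooth_on_has_derivative[OF assms(2,3)]
        cutoff_has_derivative[of n "u x", unfolded has_field_derivative_def]] .
  then have "((\<lambda>x. if x \<in> \<Omega> then cutoff n (u x) else 0) has_derivative
      (\<lambda>v. cutoff_deriv n (u x) * partial_deriv v u x)) (at x)"
    by (rule has_derivative_transform_within_open[OF _ assms(1,3)]) simp
  then show ?thesis by (rule partial_deriv_eqI)
qed

text \<open>Truncating \<open>u\<close> near zero yields, in the limit, the weak derivative \<open>1\<^bsub>u \<noteq> 0\<^esub> \<partial>\<^sub>b u\<close>; by uniqueness it
  equals \<open>\<partial>\<^sub>b u\<close>, so that \<open>\<partial>\<^sub>b u\<close> vanishes almost everywhere on the zero set of \<open>u\<close>.\<close>

lemma partial_deriv_eq_0_on_zero_set: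
  fixes \<Omega> :: "'a::euclidean_space set"
  assumes "open \<Omega>" "bounded \<Omega>" "smooth_on \<Omega> u" "continuous_on (closure \<Omega>) u"
    "\<And>x. x \<in> frontier \<Omega> \<Longrightarrow> u x = 0" "u \<in> L2 \<Omega>" "partial_deriv b u \<in> L2 \<Omega>"
  shows "AE x in lebesgue_on \<Omega>. u x = 0 \<longrightarrow> partial_deriv b u x = 0"
proof -
  define D where "D = (\<lambda>x. (if u x = 0 then 0 else 1) * partial_deriv b u x)"
  let ?\<phi> = "\<lambda>n x. if x \<in> \<Omega> then cutoff n (u x) else 0"
  have \<phi>: "?\<phi> n \<in> test_functions \<Omega>" for n
    using assms(1-5) by (rule cutoff_in_test_functions)
  note um[measurable] = L2_measurable[OF assms(6)]
  note dum[measurable] = L2_measurable[OF assms(7)]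
  have D_measurable[measurable]: "D \<in> borel_measurable (lebesgue_on \<Omega>)"
    unfolding D_def by measurable
  have "D \<in> L2 \<Omega>"
  proof -
    have "integrable (lebesgue_on \<Omega>) (\<lambda>x. (D x)\<^sup>2)"
      by (rule Bochner_Integration.integrable_bound[OF L2_square_integrable[OF assms(7)]])
        (auto simp: D_def)
    then show ?thesis using D_measurable by (simp add: L2_def)
  qed
  moreover have "has_weak_deriv \<Omega> {#b#} u D"
    unfolding has_weak_deriv_def
  proof
    fix \<psi> assume \<psi>: "\<psi> \<in> test_functions \<Omega>"
    note d\<psi> = test_functions_partial_deriv[OF \<psi>, of b]
    note [measurable] = measurable_lebesgue_on_of_borel[OF test_functions_measurable[OF \<psi>], where S = \<Omega>]
      measurable_lebesgue_on_of_borel[OF test_functions_measurable[OF d\<psi>], where S = \<Omega>]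
      measurable_lebesgue_on_of_borel[OF test_functions_measurable[OF \<phi>], where S = \<Omega>]
      measurable_lebesgue_on_of_borel[OF test_functions_measurable[OF test_functions_partial_deriv[OF \<phi>]], where S = \<Omega>]
    \<comment> \<open>\<open>lim1\<close> and \<open>lim2\<close> are the limits of the two sides of
      integration by parts for the truncations. The bounds \<open>cutoff_bound\<close> and
      \<open>cutoff_deriv_bound\<close> supply the dominating functions.\<close>
    have lim1: "(\<lambda>n. LINT x|lebesgue_on \<Omega>. ?\<phi> n x * partial_deriv b \<psi> x) \<longlonglongrightarrow>
        (LINT x|lebesgue_on \<Omega>. u x * partial_deriv b \<psi> x)"
    proof (rule integral_dominated_convergence[where w = "\<lambda>x. \<bar>u x * partial_deriv b \<psi> x\<bar>"])
      show "integrable (lebesgue_on \<Omega>) (\<lambda>x. \<bar>u x * partial_deriv b \<psi> x\<bar>)"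
        using L2_times_test_function_integrable[OF assms(1,2,6) d\<psi>] by (rule integrable_abs)
      show "AE x in lebesgue_on \<Omega>. (\<lambda>n. ?\<phi> n x * partial_deriv b \<psi> x) \<longlonglongrightarrow> u x * partial_deriv b \<psi> x"
        by (intro AE_I2 tendsto_mult tendsto_const) (simp add: cutoff_tendsto)
      show "AE x in lebesgue_on \<Omega>. norm (?\<phi> n x * partial_deriv b \<psi> x) \<le> \<bar>u x * partial_deriv b \<psi> x\<bar>" for n
        by (intro AE_I2) (simp add: abs_mult mult_right_mono cutoff_bound)
    qed measurable
    have lim2: "(\<lambda>n. LINT x|lebesgue_on \<Omega>. partial_deriv b (?\<phi> n) x * \<psi> x) \<longlonglongrightarrow>
        (LINT x|lebesgue_on \<Omega>. D x * \<psi> x)"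
    proof (rule integral_dominated_convergence[where w = "\<lambda>x. 4 * \<bar>partial_deriv b u x * \<psi> x\<bar>"])
      show "integrable (lebesgue_on \<Omega>) (\<lambda>x. 4 * \<bar>partial_deriv b u x * \<psi> x\<bar>)"
        using L2_times_test_function_integrable[OF assms(1,2,7) \<psi>] by (intro integrable_mult_right integrable_abs)
      show "AE x in lebesgue_on \<Omega>. (\<lambda>n. partial_deriv b (?\<phi> n) x * \<psi> x) \<longlonglongrightarrow> D x * \<psi> x"
        unfolding D_def
        by (intro AE_I2 tendsto_mult tendsto_const)
          (simp add: partial_deriv_cutoff[OF assms(1,3)] tendsto_mult[OF cutoff_deriv_tendsto tendsto_const])
      show "AE x in lebesgue_on \<Omega>. norm (partial_deriv b (?\<phi> n) x * \<psi> x) \<le> 4 * \<bar>partial_deriv b u x * \<psi> x\<bar>" for n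
        using cutoff_deriv_bound[of n]
        by (intro AE_I2) (simp add: partial_deriv_cutoff[OF assms(1,3)] abs_mult mult.assoc mult_right_mono)
    qed measurable
    have "(LINT x|lebesgue_on \<Omega>. ?\<phi> n x * partial_deriv b \<psi> x) =
        - (LINT x|lebesgue_on \<Omega>. partial_deriv b (?\<phi> n) x * \<psi> x)" for n
      by (rule integral_by_parts_test_function[OF assms(1) test_functions_smooth[OF \<phi>] \<psi>])
    then have "(LINT x|lebesgue_on \<Omega>. u x * partial_deriv b \<psi> x) = - (LINT x|lebesgue_on \<Omega>. D x * \<psi> x)"
      using LIMSEQ_unique[OF lim1] tendsto_minus[OF lim2] by presburger
    then show "(LINT x|lebesgue_on \<Omega>. u x * multi_partial {#b#} \<psi> x) =
        (- 1) ^ size {#b#} * (LINT x|lebesgue_on \<Omega>. D x * \<psi> x)"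
      by (simp add: multi_partial_single)
  qed
  ultimately have "AE x in lebesgue_on \<Omega>. D x = partial_deriv b u x"
    using weak_deriv_unique[OF assms(1,2) _ assms(7) _ smooth_on_has_weak_deriv_single[OF assms(1,3)]] by blast
  then show ?thesis
    by eventually_elim (auto simp: D_def)
qed

lemma multi_index_le_1_cases:
  assumes "\<alpha> \<in> multi_indices" "size \<alpha> \<le> 1"
  obtains "\<alpha> = {#}" | b where "b \<in> Basis" "\<alpha> = {#b#}"
proof (cases "\<alpha> = {#}")
  case False
  then have "size \<alpha> = 1"
    using assms(2) by (metis One_nat_def le_SucE le_zero_eq size_eq_0_iff_empty)
  then obtain b where "\<alpha> = {#b#}" using size_1_singleton_mset by blast
  then show ?thesis using assms(1) that(2) by (auto simp: multi_indices_def)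
qed (rule that(1))

text \<open>The truncations are the approximating sequence. Their derivatives tend to the derivative
  of \<open>u\<close> off its zero set and to 0 on it, where the derivative of \<open>u\<close>
  itself is 0 almost everywhere.\<close>

lemma smooth_on_closure_in_H10:
  fixes \<Omega> :: "'a::euclidean_space set"
  assumes "open \<Omega>" "bounded \<Omega>" "smooth_on_closure \<Omega> u" "\<And>x. x \<in> frontier \<Omega> \<Longrightarrow> u x = 0"
  shows "u \<in> H10 \<Omega>"
proof -
  let ?\<phi> = "\<lambda>n x. if x \<in> \<Omega> then cutoff n (u x) else 0"
  have sm: "smooth_on \<Omega> u" and cont: "continuous_on (closure \<Omega>) u"
    using assms(3) by (auto simp: smooth_on_closure_def)
  have \<phi>: "?\<phi> n \<in> test_functions \<Omega>" for n
    using assms(1,2) sm cont assms(4) by (rule cutoff_in_test_functions)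
  note d\<phi> = test_functions_partial_deriv[OF \<phi>]
  have uL: "u \<in> L2 \<Omega>"
    using iter_partial_in_L2[OF assms(1-3), of "[]"] by (simp add: iter_partial_def)
  have dL: "partial_deriv b u \<in> L2 \<Omega>" if "b \<in> Basis" for b
    using iter_partial_in_L2[OF assms(1-3), of "[b]"] that by (simp add: iter_partial_def)
  \<comment> \<open>The derivatives have to be indexed by multi-indices. Only sizes 0 and 1 occur,
    and \<open>THE\<close> recovers the direction from a singleton.\<close>
  define g where "g = (\<lambda>n \<alpha> x. if \<alpha> = {#} then u x - ?\<phi> n x
    else partial_deriv (THE b. \<alpha> = {#b#}) u x - partial_deriv (THE b. \<alpha> = {#b#}) (?\<phi> n) x)"
  have g_empty: "g n {#} = (\<lambda>x. u x - ?\<phi> n x)" for n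
    by (simp add: g_def)
  have g_single: "g n {#b#} = (\<lambda>x. partial_deriv b u x - partial_deriv b (?\<phi> n) x)" for n b
    by (simp add: g_def)
  note [measurable] = L2_measurable[OF uL]
    measurable_lebesgue_on_of_borel[OF test_functions_measurable[OF \<phi>], where S = \<Omega>]
    measurable_lebesgue_on_of_borel[OF test_functions_measurable[OF d\<phi>], where S = \<Omega>]
  have "(\<lambda>n. sobolev_norm 1 \<Omega> (\<lambda>x. u x - ?\<phi> n x)) \<longlonglongrightarrow> 0"
  proof (rule sobolev_norm_tendsto_0I[OF assms(1,2), where g = g])
    fix n and \<alpha> :: "'a multiset" assume \<alpha>: "\<alpha> \<in> multi_indices" "size \<alpha> \<le> 1"
    from \<alpha> show "g n \<alpha> \<in> L2 \<Omega> \<and> has_weak_deriv \<Omega> \<alpha> (\<lambda>x. u x - ?\<phi> n x) (g n \<alpha>)"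
    proof (cases rule: multi_index_le_1_cases)
      case 1
      then show ?thesis
        using L2_diff[OF uL test_functions_in_L2[OF assms(1,2) \<phi>]]
        by (simp only: g_empty has_weak_deriv_empty simp_thms)
    next
      case (2 b)
      note d\<phi>L = test_functions_in_L2[OF assms(1,2) d\<phi>]
      have "has_weak_deriv \<Omega> {#b#} (\<lambda>x. u x - ?\<phi> n x) (\<lambda>x. partial_deriv b u x - partial_deriv b (?\<phi> n) x)"
        by (rule has_weak_deriv_diff[OF assms(1,2) uL test_functions_in_L2[OF assms(1,2) \<phi>] dL[OF 2(1)] d\<phi>L
              smooth_on_has_weak_deriv_single[OF assms(1) sm]
              smooth_on_has_weak_deriv_single[OF assms(1) test_functions_smooth[OF \<phi>]]])
      then show ?thesis
        using L2_diff[OF dL[OF 2(1)] d\<phi>L] unfolding 2(2) g_single by blast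
    qed
  next
    fix \<alpha> :: "'a multiset" assume \<alpha>: "\<alpha> \<in> multi_indices" "size \<alpha> \<le> 1"
    from \<alpha> show "(\<lambda>n. LINT x|lebesgue_on \<Omega>. (g n \<alpha> x)\<^sup>2) \<longlonglongrightarrow> 0"
    proof (cases rule: multi_index_le_1_cases)
      case 1
      have "(\<lambda>n. LINT x|lebesgue_on \<Omega>. (u x - ?\<phi> n x)\<^sup>2) \<longlonglongrightarrow> (LINT x|lebesgue_on \<Omega>. 0)"
      proof (rule integral_dominated_convergence[where w = "\<lambda>x. (u x)\<^sup>2"])
        show "AE x in lebesgue_on \<Omega>. (\<lambda>n. (u x - ?\<phi> n x)\<^sup>2) \<longlonglongrightarrow> 0"
        proof (rule AE_I2)
          fix x assume "x \<in> space (lebesgue_on \<Omega>)"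
          moreover have "(\<lambda>n. (u x - cutoff n (u x))\<^sup>2) \<longlonglongrightarrow> (u x - u x)\<^sup>2"
            by (intro tendsto_intros cutoff_tendsto)
          ultimately show "(\<lambda>n. (u x - ?\<phi> n x)\<^sup>2) \<longlonglongrightarrow> 0" by simp
        qed
        show "AE x in lebesgue_on \<Omega>. norm ((u x - ?\<phi> n x)\<^sup>2) \<le> (u x)\<^sup>2" for n
          using cutoff_diff_bound by (intro AE_I2) (simp add: abs_le_square_iff)
      qed (use L2_square_integrable[OF uL] in measurable)
      then show ?thesis unfolding 1 g_empty by simp
    next
      case (2 b)
      note [measurable] = L2_measurable[OF dL[OF 2(1)]]
      have "(\<lambda>n. LINT x|lebesgue_on \<Omega>. (partial_deriv b u x - partial_deriv b (?\<phi> n) x)\<^sup>2)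
          \<longlonglongrightarrow> (LINT x|lebesgue_on \<Omega>. 0)"
      \<comment> \<open>The factor 1 - \<open>cutoff_deriv n (u x)\<close> is at most 1 + 4 in
        absolute value, hence 25.\<close>
      proof (rule integral_dominated_convergence[where w = "\<lambda>x. 25 * (partial_deriv b u x)\<^sup>2"])
        show "integrable (lebesgue_on \<Omega>) (\<lambda>x. 25 * (partial_deriv b u x)\<^sup>2)"
          by (intro integrable_mult_right L2_square_integrable dL 2(1))
        have "AE x in lebesgue_on \<Omega>. x \<in> \<Omega>" by (rule AE_I2) simp
        moreover have "AE x in lebesgue_on \<Omega>. u x = 0 \<longrightarrow> partial_deriv b u x = 0"
          using assms(1,2) sm cont assms(4) uL dL[OF 2(1)] by (rule partial_deriv_eq_0_on_zero_set)
        ultimately show "AE x in lebesgue_on \<Omega>. (\<lambda>n. (partial_deriv b u x - partial_deriv b (?\<phi> n) x)\<^sup>2) \<longlonglongrightarrow> 0"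
        proof eventually_elim
          case (elim x)
          have "(\<lambda>n. (partial_deriv b u x - cutoff_deriv n (u x) * partial_deriv b u x)\<^sup>2) \<longlonglongrightarrow>
              (partial_deriv b u x - (if u x = 0 then 0 else 1) * partial_deriv b u x)\<^sup>2"
            by (intro tendsto_intros cutoff_deriv_tendsto)
          moreover have "partial_deriv b u x - (if u x = 0 then 0 else 1) * partial_deriv b u x = 0"
            using elim by auto
          ultimately show ?case
            using elim by (simp add: partial_deriv_cutoff[OF assms(1) sm])
        qed
        show "AE x in lebesgue_on \<Omega>. norm ((partial_deriv b u x - partial_deriv b (?\<phi> n) x)\<^sup>2)
            \<le> 25 * (partial_deriv b u x)\<^sup>2" for n
        proof (rule AE_I2)
          fix x assume "x \<in> space (lebesgue_on \<Omega>)"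
          then have "partial_deriv b u x - partial_deriv b (?\<phi> n) x = (1 - cutoff_deriv n (u x)) * partial_deriv b u x"
            by (simp add: partial_deriv_cutoff[OF assms(1) sm] algebra_simps)
          moreover have "(1 - cutoff_deriv n (u x))\<^sup>2 \<le> 5\<^sup>2"
            using cutoff_deriv_bound[of n "u x"] by (intro iffD1[OF abs_le_square_iff]) auto
          ultimately show "norm ((partial_deriv b u x - partial_deriv b (?\<phi> n) x)\<^sup>2) \<le> 25 * (partial_deriv b u x)\<^sup>2"
            by (simp add: power_mult_distrib mult_right_mono)
        qed
      qed measurable
      then show ?thesis unfolding 2(2) g_single by simp
    qed
  qed
  then show ?thesis
    using \<phi> smooth_on_closure_in_sobolev[OF assms(1-3)] unfolding H10_def
    by (intro CollectI conjI exI[of _ ?\<phi>]) auto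
qed

section \<open>Galerkin approximation\<close>

text \<open>The coefficient \<open>a\<close> is scalar, so the form is symmetric, and linearity in
  the second argument can be read off from the first.\<close>

lemma B_form_commute: "B_form \<Omega> a c u v = B_form \<Omega> a c v u"
  by (simp add: B_form_def B_integrand_def inner_commute mult.assoc mult.commute[of "u _" "v _"])

lemma weak_grad_diff_AE:
  fixes \<Omega> :: "'a::euclidean_space set"
  assumes "open \<Omega>" "bounded \<Omega>" "u \<in> H10 \<Omega>" "v \<in> H10 \<Omega>"
  shows "AE x in lebesgue_on \<Omega>. weak_grad \<Omega> (\<lambda>x. u x - v x) x = weak_grad \<Omega> u x - weak_grad \<Omega> v x"
proof -
  have "AE x in lebesgue_on \<Omega>. \<forall>b\<in>Basis. weak_deriv \<Omega> {#b#} (\<lambda>x. u x - v x) x =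
      weak_deriv \<Omega> {#b#} u x - weak_deriv \<Omega> {#b#} v x"
    using assms
    by (intro AE_finite_allI weak_deriv_diff_AE[where n = 1] H10_sobolev) (auto simp: multi_indices_def)
  then show ?thesis
    by eventually_elim (simp add: weak_grad_def scaleR_diff_left sum_subtractf)
qed

text \<open>The weak gradient of a difference is a fresh choice that agrees with the difference of
  gradients only almost everywhere. Integrability, which \<open>B_continuous\<close> demands,
  permits splitting the integral.\<close>

lemma B_form_diff_left:
  fixes \<Omega> :: "'a::euclidean_space set"
  assumes "open \<Omega>" "bounded \<Omega>" "B_continuous \<Omega> a c" "u \<in> H10 \<Omega>" "v \<in> H10 \<Omega>" "w \<in> H10 \<Omega>"
  shows "B_form \<Omega> a c (\<lambda>x. u x - v x) w = B_form \<Omega> a c u w - B_form \<Omega> a c v w"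
proof -
  have int: "integrable (lebesgue_on \<Omega>) (B_integrand \<Omega> a c y w)" if "y \<in> H10 \<Omega>" for y
    using assms(3,6) that by (auto simp: B_continuous_def)
  have "B_form \<Omega> a c (\<lambda>x. u x - v x) w =
      (LINT x|lebesgue_on \<Omega>. B_integrand \<Omega> a c u w x - B_integrand \<Omega> a c v w x)"
    unfolding B_form_def
  proof (rule integral_cong_AE)
    show "B_integrand \<Omega> a c (\<lambda>x. u x - v x) w \<in> borel_measurable (lebesgue_on \<Omega>)"
      by (intro borel_measurable_integrable int H10_diff assms)
    show "(\<lambda>x. B_integrand \<Omega> a c u w x - B_integrand \<Omega> a c v w x) \<in> borel_measurable (lebesgue_on \<Omega>)"
      by (intro borel_measurable_integrable Bochner_Integration.integrable_diff int assms)
    show "AE x in lebesgue_on \<Omega>. B_integrand \<Omega> a c (\<lambda>x. u x - v x) w x =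
        B_integrand \<Omega> a c u w x - B_integrand \<Omega> a c v w x"
      using weak_grad_diff_AE[OF assms(1,2,4,5)]
      by eventually_elim (simp add: B_integrand_def inner_diff_left right_diff_distrib left_diff_distrib)
  qed
  also have "\<dots> = B_form \<Omega> a c u w - B_form \<Omega> a c v w"
    unfolding B_form_def by (intro Bochner_Integration.integral_diff int assms)
  finally show ?thesis .
qed

lemma B_form_diff_right:
  fixes \<Omega> :: "'a::euclidean_space set"
  assumes "open \<Omega>" "bounded \<Omega>" "B_continuous \<Omega> a c" "u \<in> H10 \<Omega>" "v \<in> H10 \<Omega>" "w \<in> H10 \<Omega>"
  shows "B_form \<Omega> a c w (\<lambda>x. u x - v x) = B_form \<Omega> a c w u - B_form \<Omega> a c w v"
  using B_form_diff_left[OF assms] by (simp add: B_form_commute[of _ _ _ w])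

section \<open>Finite element spaces and quasi-optimality\<close>

lemma poly_functions_diff:
  assumes "p \<in> poly_functions k" "q \<in> poly_functions k"
  shows "(\<lambda>x. p x - q x) \<in> poly_functions k"
proof -
  obtain f where f: "\<And>x. p x = (\<Sum>\<alpha>\<in>{\<alpha>\<in>multi_indices. size \<alpha> \<le> k}. f \<alpha> * (\<Prod>b\<in>#\<alpha>. x \<bullet> b))"
    using assms(1) by (auto simp: poly_functions_def)
  obtain g where g: "\<And>x. q x = (\<Sum>\<alpha>\<in>{\<alpha>\<in>multi_indices. size \<alpha> \<le> k}. g \<alpha> * (\<Prod>b\<in>#\<alpha>. x \<bullet> b))"
    using assms(2) by (auto simp: poly_functions_def)
  show ?thesis
    unfolding poly_functions_def f g
    by (intro CollectI exI[of _ "\<lambda>\<alpha>. f \<alpha> - g \<alpha>"]) (simp add: left_diff_distrib sum_subtractf)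
qed

lemma fe_space_H10: "v \<in> fe_space \<Omega> k T \<Longrightarrow> v \<in> H10 \<Omega>"
  by (simp add: fe_space_def)

lemma fe_space_diff:
  fixes \<Omega> :: "'a::euclidean_space set"
  assumes "open \<Omega>" "bounded \<Omega>" "u \<in> fe_space \<Omega> k T" "v \<in> fe_space \<Omega> k T"
  shows "(\<lambda>x. u x - v x) \<in> fe_space \<Omega> k T"
proof -
  have "\<exists>p\<in>poly_functions k. \<forall>x\<in>K. u x - v x = p x" if K: "K \<in> T" for K
  proof -
    obtain p where p: "p \<in> poly_functions k" "\<forall>x\<in>K. u x = p x"
      using assms(3) K by (auto simp: fe_space_def)
    obtain q where q: "q \<in> poly_functions k" "\<forall>x\<in>K. v x = q x"
      using assms(4) K by (auto simp: fe_space_def)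
    show ?thesis
      using p q by (intro bexI[OF _ poly_functions_diff[OF p(1) q(1)]]) simp
  qed
  then show ?thesis
    using assms by (auto simp: fe_space_def intro: H10_diff)
qed

text \<open>By Galerkin orthogonality the test function \<open>w - w\<^sub>h\<close> may be replaced by \<open>w - v\<^sub>h\<close>.\<close>

lemma Cea_quasi_optimality:
  fixes \<Omega> :: "'a::euclidean_space set"
  assumes "open \<Omega>" "bounded \<Omega>" "B_continuous \<Omega> a c"
    and upper: "\<And>u v. u \<in> H10 \<Omega> \<Longrightarrow> v \<in> H10 \<Omega> \<Longrightarrow>
      \<bar>B_form \<Omega> a c u v\<bar> \<le> \<alpha> * sobolev_norm 1 \<Omega> u * sobolev_norm 1 \<Omega> v"
    and lower: "\<And>u. u \<in> H10 \<Omega> \<Longrightarrow> \<beta> * (sobolev_norm 1 \<Omega> u)\<^sup>2 \<le> \<bar>B_form \<Omega> a c u u\<bar>"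
    and "\<alpha> \<ge> 0" "\<beta> > 0"
    and w: "w \<in> H10 \<Omega>" and wh: "wh \<in> fe_space \<Omega> k T" and vh: "vh \<in> fe_space \<Omega> k T"
    and galerkin: "\<And>v. v \<in> fe_space \<Omega> k T \<Longrightarrow> B_form \<Omega> a c wh v = B_form \<Omega> a c w v"
  shows "sobolev_norm 1 \<Omega> (\<lambda>x. w x - wh x) \<le> \<alpha> / \<beta> * sobolev_norm 1 \<Omega> (\<lambda>x. w x - vh x)"
proof -
  define e where "e = (\<lambda>x. w x - wh x)"
  let ?N = "sobolev_norm 1 \<Omega>"
  note H10 = fe_space_H10[OF wh] fe_space_H10[OF vh] w
  have e: "e \<in> H10 \<Omega>" and wv: "(\<lambda>x. w x - vh x) \<in> H10 \<Omega>"
    unfolding e_def by (intro H10_diff assms(1,2) H10)+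
  have d: "(\<lambda>x. wh x - vh x) \<in> fe_space \<Omega> k T"
    by (intro fe_space_diff assms(1,2) wh vh)
  have "e = (\<lambda>x. (w x - vh x) - (wh x - vh x))"
    by (simp add: e_def)
  then have "B_form \<Omega> a c e e = B_form \<Omega> a c e (\<lambda>x. w x - vh x) - B_form \<Omega> a c e (\<lambda>x. wh x - vh x)"
    using B_form_diff_right[OF assms(1-3) wv fe_space_H10[OF d] e] by simp
  also have "B_form \<Omega> a c e (\<lambda>x. wh x - vh x) = 0"
    unfolding e_def using B_form_diff_left[OF assms(1-3) w H10(1) fe_space_H10[OF d]] galerkin[OF d] by simp
  finally have "\<beta> * (?N e)\<^sup>2 \<le> \<alpha> * ?N e * ?N (\<lambda>x. w x - vh x)"
    using lower[OF e] upper[OF e wv] by simp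
  then have "?N e * (\<beta> * ?N e) \<le> ?N e * (\<alpha> * ?N (\<lambda>x. w x - vh x))"
    by (simp add: power2_eq_square algebra_simps)
  \<comment> \<open>The error norm is cancelled when it is nonzero. When it is zero, the claim says
    that the right-hand side is nonnegative, which follows from \<alpha> \<ge> 0.\<close>
  then have "\<beta> * ?N e \<le> \<alpha> * ?N (\<lambda>x. w x - vh x)"
    using sobolev_norm_nonneg[of 1 \<Omega> e] sobolev_norm_nonneg[of 1 \<Omega> "\<lambda>x. w x - vh x"] \<open>\<alpha> \<ge> 0\<close>
    by (cases "?N e = 0") auto
  then show ?thesis
    using \<open>\<beta> > 0\<close> by (simp add: e_def field_simps)
qed

text \<open>The family of meshes is indexed by a set \<open>hs\<close> of mesh sizes. Independence
  of the constant is carried by the order of quantifiers: \<open>C\<close> is chosen before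
  \<open>f\<close>, \<open>u\<close>, \<open>u\<theta>\<close>, \<open>h\<close> and
  \<open>uh\<close>.\<close>

theorem theorem4p6:
  fixes \<Omega> :: "'a::euclidean_space set"
    and a c :: "'a \<Rightarrow> real"
    and m k :: nat
    and hs :: "real set"
    and T :: "real \<Rightarrow> 'a set set"
    and N :: "real \<Rightarrow> 'a set \<Rightarrow> 'a set"
    and I :: "real \<Rightarrow> ('a \<Rightarrow> real) \<Rightarrow> 'a \<Rightarrow> real"
  assumes domain: "open \<Omega>" "connected \<Omega>" "\<Omega> \<noteq> {}" "bounded \<Omega>"
    and m: "m \<ge> 2"
    and B_cont: "B_continuous \<Omega> a c"
    and B_coer: "B_coercive \<Omega> a c"
    and mesh: "\<And>h. h \<in> hs \<Longrightarrow> h > 0 \<and> subdivision \<Omega> (T h) \<and> (\<forall>K\<in>T h. diameter K \<le> h)"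
    and nodes: "\<And>h K. h \<in> hs \<Longrightarrow> K \<in> T h \<Longrightarrow> lagrange_nodes k K (N h K)"
    and interp: "\<And>h. h \<in> hs \<Longrightarrow> global_interpolator \<Omega> k (T h) (N h) m (I h)"
    and approx: "\<exists>C0. \<forall>h\<in>hs. \<forall>v\<in>sobolev m \<Omega> \<inter> H10 \<Omega>.
        sobolev_norm 1 \<Omega> (\<lambda>x. v x - I h v x) \<le> C0 * h ^ (m - 1) * sobolev_seminorm m \<Omega> v"
  shows "\<exists>C>0. \<forall>f u u\<theta>.
      F_continuous \<Omega> f \<and>
      smooth_on_closure \<Omega> u\<theta> \<and> (\<forall>x\<in>frontier \<Omega>. u\<theta> x = 0) \<and>
      u \<in> H10 \<Omega> \<inter> sobolev m \<Omega> \<and> (\<forall>v\<in>H10 \<Omega>. B_form \<Omega> a c u v = F_form \<Omega> f v) \<longrightarrow>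
      (\<forall>h\<in>hs. \<forall>uh. enriched_solution \<Omega> a c f (fe_space \<Omega> k (T h)) u\<theta> uh \<longrightarrow>
        sobolev_norm 1 \<Omega> (\<lambda>x. u x - uh x) \<le> C * h ^ (m - 1) * sobolev_seminorm m \<Omega> (\<lambda>x. u x - u\<theta> x))"
proof -
  obtain \<alpha> where \<alpha>: "\<alpha> > 0" "\<And>u v. u \<in> H10 \<Omega> \<Longrightarrow> v \<in> H10 \<Omega> \<Longrightarrow>
      \<bar>B_form \<Omega> a c u v\<bar> \<le> \<alpha> * sobolev_norm 1 \<Omega> u * sobolev_norm 1 \<Omega> v"
    using B_cont by (auto simp: B_continuous_def)
  obtain \<beta> where \<beta>: "\<beta> > 0" "\<And>u. u \<in> H10 \<Omega> \<Longrightarrow> \<beta> * (sobolev_norm 1 \<Omega> u)\<^sup>2 \<le> \<bar>B_form \<Omega> a c u u\<bar>"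
    using B_coer by (auto simp: B_coercive_def)
  obtain C0 where C0: "\<And>h v. h \<in> hs \<Longrightarrow> v \<in> sobolev m \<Omega> \<inter> H10 \<Omega> \<Longrightarrow>
      sobolev_norm 1 \<Omega> (\<lambda>x. v x - I h v x) \<le> C0 * h ^ (m - 1) * sobolev_seminorm m \<Omega> v"
    using approx by blast
  \<comment> \<open>\<open>C0\<close> may be zero or negative, while \<open>C\<close> must be
    positive; \<open>max C0 1\<close> repairs this and only enlarges a bound whose other factor is
    nonnegative.\<close>
  define C where "C = \<alpha> / \<beta> * max C0 1"
  show ?thesis
  proof (intro exI[of _ C] conjI allI impI ballI)
    show "C > 0" using \<alpha>(1) \<beta>(1) by (simp add: C_def)
    fix f u u\<theta> h uh
    assume A: "F_continuous \<Omega> f \<and>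
        smooth_on_closure \<Omega> u\<theta> \<and> (\<forall>x\<in>frontier \<Omega>. u\<theta> x = 0) \<and>
        u \<in> H10 \<Omega> \<inter> sobolev m \<Omega> \<and> (\<forall>v\<in>H10 \<Omega>. B_form \<Omega> a c u v = F_form \<Omega> f v)"
      and h: "h \<in> hs" and sol: "enriched_solution \<Omega> a c f (fe_space \<Omega> k (T h)) u\<theta> uh"
    define w where "w = (\<lambda>x. u x - u\<theta> x)"
    define wh where "wh = (\<lambda>x. uh x - u\<theta> x)"
    note dom = domain(1,4)
    have u\<theta>: "u\<theta> \<in> H10 \<Omega>" "u\<theta> \<in> sobolev m \<Omega>"
      using A by (auto intro: smooth_on_closure_in_H10 smooth_on_closure_in_sobolev dom)
    have w: "w \<in> H10 \<Omega>" "w \<in> sobolev m \<Omega>"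
      unfolding w_def using A u\<theta> by (auto intro: H10_diff sobolev_diff dom)
    have wh: "wh \<in> fe_space \<Omega> k (T h)"
      and wh_eq: "\<And>v. v \<in> fe_space \<Omega> k (T h) \<Longrightarrow> B_form \<Omega> a c wh v = F_form \<Omega> f v - B_form \<Omega> a c u\<theta> v"
      using sol by (auto simp: enriched_solution_def wh_def Let_def)
    \<comment> \<open>The comparison function interpolates \<open>w\<close> and not
      \<open>u\<close>, which is what puts the seminorm of the difference
      \<open>u - u\<theta>\<close> into the estimate.\<close>
    have vh: "I h w \<in> fe_space \<Omega> k (T h)"
      using interp[OF h] w by (auto simp: global_interpolator_def)
    have galerkin: "B_form \<Omega> a c wh v = B_form \<Omega> a c w v" if "v \<in> fe_space \<Omega> k (T h)" for v
    proof -
      note v = fe_space_H10[OF that]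
      have "B_form \<Omega> a c w v = B_form \<Omega> a c u v - B_form \<Omega> a c u\<theta> v"
        unfolding w_def using A by (intro B_form_diff_left dom B_cont u\<theta> v) auto
      then show ?thesis using wh_eq[OF that] A v by simp
    qed
    let ?S = "h ^ (m - 1) * sobolev_seminorm m \<Omega> w"
    have S: "?S \<ge> 0"
      using mesh[OF h] by (simp add: sobolev_seminorm_nonneg)
    have "sobolev_norm 1 \<Omega> (\<lambda>x. w x - wh x) \<le> \<alpha> / \<beta> * sobolev_norm 1 \<Omega> (\<lambda>x. w x - I h w x)"
      using \<alpha> \<beta> galerkin
      by (intro Cea_quasi_optimality[OF dom B_cont _ _ _ _ w(1) wh vh]) auto
    also have "\<dots> \<le> \<alpha> / \<beta> * (C0 * ?S)"
      using C0[OF h, of w] w \<alpha>(1) \<beta>(1) by (intro mult_left_mono) (auto simp: mult.assoc)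
    also have "\<dots> \<le> \<alpha> / \<beta> * (max C0 1 * ?S)"
      using \<alpha>(1) \<beta>(1) S by (intro mult_left_mono mult_right_mono) auto
    also have "\<dots> = C * h ^ (m - 1) * sobolev_seminorm m \<Omega> w"
      by (simp add: C_def mult.assoc)
    finally show "sobolev_norm 1 \<Omega> (\<lambda>x. u x - uh x) \<le> C * h ^ (m - 1) * sobolev_seminorm m \<Omega> (\<lambda>x. u x - u\<theta> x)"
      by (simp add: w_def wh_def)
  qed
qed

end
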